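(* The map $\mathcal{I}_h$ is a homotopy invariant of virtual pseudoknots. That is, if $P$ and $P'$ are pseudo-Gauss diagrams of homotopic virtual pseudoknots (i.e. $P$ and $P'$ are related by a finite sequence of the Gauss-diagrammatic moves R1, R2, R3, PR1, PR2, PR3 and crossing changes), then $\mathcal{I}_h(P)=\mathcal{I}_h(P')$ in $\mathbb{Z}_2\mathcal{C}$.
   Context: **Pseudo-Gauss diagrams.** A pseudo-Gauss diagram is an oriented (counterclockwise) circle together with finitely many chords whose endpoints are pairwise distinct points of the circle. Each chord is an arrow (one endpoint is its tail, the other its head) of one of two kinds: a *classical arrow*, which carries a sign $+1$ or $-1$, or a *precrossing arrow*, which carries no sign. Diagrams are considered up to orientation-preserving homeomorphism of the circle. Two chords *intersect* if their endpoints alternate on the circle. (Geometrically, a classical arrow is a crossing, pointing from over-strand to under-strand, with sign the crossing sign; a precrossing arrow is a double point with missing crossing information, pointing in the direction the classical arrow would point if it were resolved to a positive crossing.) **Moves.** In each move the displayed arcs of the circle are disjoint and contain no chord endpoints other than those mentioned; everything else is unchanged. Each move may be performed in either direction. - R1: add or delete a classical arrow (any sign and direction) whose two endpoints lie consecutively on one arc. - R2: add or delete two classical arrows of opposite signs, whose two tails are consecutive on one arc and whose two heads are consecutive on another arc (in either order). - R3: there are three arcs $T,M,B$ and three classical arrows $a$ (from $T$ to $M$), $b$ (from $T$ to $B$), $c$ (from $M$ to $B$) with signs $\varepsilon_a,\varepsilon_b,\varepsilon_c$. Put $o_T=+1$ if $a$ precedes $b$ on $T$ and $-1$ otherwise;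 $o_M=+1$ if $a$ precedes $c$ on $M$ and $-1$ otherwise; $o_B=+1$ if $b$ precedes $c$ on $B$ and $-1$ otherwise. If $o_M\varepsilon_a=o_B\varepsilon_b=o_T\varepsilon_a\varepsilon_b\varepsilon_c$, the move exchanges the two endpoints on each of the three arcs, keeping all signs and arrow directions. - PR1: add or delete a precrossing arrow (any direction) whose two endpoints lie consecutively on one arc. - PR2: there are two arcs, each containing exactly one endpoint of a classical arrow $x$ and one endpoint of a precrossing arrow $p$, where $x$ and $p$ point to different arcs if $x$ is positive and to the same arc if $x$ is negative. The move exchanges the two endpoints on each of the two arcs, keeps the sign of $x$, and reverses the directions of both $x$ and $p$ (so that each arrow now points to the arc it previously came from). - PR3: there are three arcs $T,X,Y$, a precrossing arrow $p$ from $X$ to $Y$, a classical arrow $a$ joining $T$ and $X$, and a classical arrow $b$ joining $T$ and $Y$, with signs $\varepsilon_a,\varepsilon_b$; either both $a,b$ have their tails on $T$ (put $\eta=1$), or both have their heads on $T$ (put $\eta=-1$). Put $o_T=+1$ if $a$ precedes $b$ on $T$ and $-1$ otherwise; $o_X=+1$ if $a$ precedes $p$ on $X$ and $-1$ otherwise; $o_Y=+1$ if $b$ precedes $p$ on $Y$ and $-1$ otherwise. If $\eta\, o_X\varepsilon_a=\eta\, o_Y\varepsilon_b=o_T\varepsilon_a\varepsilon_b$, the move exchanges the two endpoints on each of the three arcs, keeping signs and directions. - Crossing change: reverse the direction of one classical arrow and change its sign. A *virtual pseudoknot* is an equivalence class of pseudo-Gauss diagrams under the relation generated by R1, R2, R3,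 PR1, PR2, PR3. Two virtual pseudoknots are *homotopic* if their diagrams are related by a finite sequence of these moves and crossing changes. **The map $\mathcal{I}_h$.** Let $\mathbb{Z}_2\mathcal{C}$ be the set of all chord diagrams (on an oriented circle, up to orientation-preserving homeomorphism) in which each chord is decorated with a $0$ or $1$. For a pseudo-Gauss diagram $P$, $\mathcal{I}_h(P)\in\mathbb{Z}_2\mathcal{C}$ is obtained as follows: 1. Replace all arrows in $P$ that are associated to precrossings with unoriented chords, called *prechords*. 2. Decorate each prechord $c$ with the $\mathbb{Z}_2$ value $p(c)$, the parity of the number of classical arrows that intersect $c$. 3. Delete all classical arrows. 4. Delete any prechords $c$ that have adjacent endpoints and $p(c)=0$. *)

theory Defs
  imports
    "HOL-Analysis.Analysis"
    "HOL-Library.Z2"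
    "HOL-Combinatorics.Transposition"
begin

section \<open>The oriented circle\<close>

definition circle :: "complex set" where
  "circle = sphere 0 1"

text \<open>The open arc travelled counterclockwise from \<open>x\<close> to \<open>y\<close>.\<close>

definition ccw_arc :: "complex \<Rightarrow> complex \<Rightarrow> complex set" where
  "ccw_arc x y =
    {cis t | t. \<exists>a b. x = cis a \<and> y = cis b \<and> a < t \<and> t < b \<and> b \<le> a + 2 * pi}"

text \<open>A homeomorphism of the circle preserves the orientation iff it lifts, along the covering
  \<open>cis\<close> of the circle by the line, to an increasing map commuting with the deck transformation.
  Only the values of \<open>h\<close> on the circle are relevant.\<close>

definition orientation_preserving_homeo :: "(complex \<Rightarrow> complex) \<Rightarrow> bool" where
  "orientation_preserving_homeo h \<longleftrightarrow>
    (\<exists>g. homeomorphism circle circle h g) \<and>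
    (\<exists>f :: real \<Rightarrow> real. continuous_on UNIV f \<and> strict_mono f \<and>
       (\<forall>t. f (t + 2 * pi) = f t + 2 * pi) \<and> (\<forall>t. h (cis t) = cis (f t)))"

text \<open>Travelling counterclockwise from \<open>u\<close>, the next point of \<open>E\<close> is \<open>v\<close>
  (for \<open>u, v \<in> E\<close>).\<close>

definition consecutive :: "complex set \<Rightarrow> complex \<Rightarrow> complex \<Rightarrow> bool" where
  "consecutive E u v \<longleftrightarrow> u \<noteq> v \<and> ccw_arc u v \<inter> E = {}"

definition adjacent :: "complex set \<Rightarrow> complex \<Rightarrow> complex \<Rightarrow> bool" where
  "adjacent E u v \<longleftrightarrow> consecutive E u v \<or> consecutive E v u"

text \<open>Chords are represented by their sets of endpoints; two chords intersect if their endpoints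
  alternate.\<close>

definition intersecting :: "complex set \<Rightarrow> complex set \<Rightarrow> bool" where
  "intersecting c d \<longleftrightarrow>
    (\<exists>x y z w. c = {x, y} \<and> d = {z, w} \<and> z \<in> ccw_arc x y \<and> w \<in> ccw_arc y x)"


section \<open>Pseudo-Gauss diagrams\<close>

datatype kind = Classical int | Precrossing

datatype arrow = Arrow (tail: complex) (head: complex) (kind: kind)

definition ends :: "arrow \<Rightarrow> complex set" where
  "ends a = {tail a, head a}"

definition endpoints :: "arrow set \<Rightarrow> complex set" where
  "endpoints P = (\<Union>a\<in>P. ends a)"

definition pseudo_Gauss_diagram :: "arrow set \<Rightarrow> bool" where
  "pseudo_Gauss_diagram P \<longleftrightarrow>
    finite P \<and>
    (\<forall>a\<in>P. ends a \<subseteq> circle \<and> tail a \<noteq> head a \<and>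
            kind a \<in> {Classical 1, Classical (-1), Precrossing}) \<and>
    (\<forall>a\<in>P. \<forall>b\<in>P. a \<noteq> b \<longrightarrow> ends a \<inter> ends b = {})"

fun relocate :: "(complex \<Rightarrow> complex) \<Rightarrow> arrow \<Rightarrow> arrow" where
  "relocate h (Arrow t s k) = Arrow (h t) (h s) k"

fun reverse :: "arrow \<Rightarrow> arrow" where
  "reverse (Arrow t s k) = Arrow s t k"

definition diagram_homeo :: "arrow set \<Rightarrow> arrow set \<Rightarrow> bool" where
  "diagram_homeo P Q \<longleftrightarrow> (\<exists>h. orientation_preserving_homeo h \<and> Q = relocate h ` P)"


section \<open>Moves\<close>

text \<open>The displayed arcs of a move are encoded by pairs of endpoints that are adjacent on the circle:
  the arc between them contains no other endpoint of the diagram. Arcs spanned by disjoint such pairs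
  are automatically disjoint, since a point common to two of them would force an endpoint of one to
  lie inside the other.\<close>

text \<open>\<open>arc_sign P u v s\<close>: the endpoints \<open>u\<close> and \<open>v\<close> lie on a common displayed arc, and \<open>s\<close> is
  \<open>+1\<close> if \<open>u\<close> precedes \<open>v\<close> there and \<open>-1\<close> otherwise.\<close>

definition arc_sign :: "arrow set \<Rightarrow> complex \<Rightarrow> complex \<Rightarrow> int \<Rightarrow> bool" where
  "arc_sign P u v s \<longleftrightarrow>
    (s = 1 \<and> consecutive (endpoints P) u v) \<or> (s = -1 \<and> consecutive (endpoints P) v u)"

text \<open>The tail for \<open>\<eta> = 1\<close>, the head for \<open>\<eta> = -1\<close>.\<close>

definition end_of :: "int \<Rightarrow> arrow \<Rightarrow> complex" where
  "end_of \<eta> a = (if \<eta> = 1 then tail a else head a)"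

abbreviation exchange :: "complex \<Rightarrow> complex \<Rightarrow> complex \<Rightarrow> complex" where
  "exchange \<equiv> Transposition.transpose"

text \<open>The moves R1, R2 and PR1 are given in the deleting direction only; the relation
  \<open>homotopic_diagrams\<close> below is closed under inverses.\<close>

inductive pseudo_move :: "arrow set \<Rightarrow> arrow set \<Rightarrow> bool" where
  R1: "\<lbrakk>a \<in> P; kind a = Classical \<epsilon>; adjacent (endpoints P) (tail a) (head a)\<rbrakk>
    \<Longrightarrow> pseudo_move P (P - {a})"
| R2: "\<lbrakk>a \<in> P; b \<in> P; a \<noteq> b; kind a = Classical \<epsilon>; kind b = Classical (- \<epsilon>);
     adjacent (endpoints P) (tail a) (tail b); adjacent (endpoints P) (head a) (head b)\<rbrakk>
    \<Longrightarrow> pseudo_move P (P - {a, b})"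
| R3: "\<lbrakk>a \<in> P; b \<in> P; c \<in> P; distinct [a, b, c];
     kind a = Classical \<epsilon>\<^sub>a; kind b = Classical \<epsilon>\<^sub>b; kind c = Classical \<epsilon>\<^sub>c;
     arc_sign P (tail a) (tail b) o\<^sub>T; arc_sign P (head a) (tail c) o\<^sub>M;
     arc_sign P (head b) (head c) o\<^sub>B;
     o\<^sub>M * \<epsilon>\<^sub>a = o\<^sub>B * \<epsilon>\<^sub>b; o\<^sub>B * \<epsilon>\<^sub>b = o\<^sub>T * \<epsilon>\<^sub>a * \<epsilon>\<^sub>b * \<epsilon>\<^sub>c;
     \<sigma> = exchange (tail a) (tail b) \<circ> exchange (head a) (tail c) \<circ> exchange (head b) (head c)\<rbrakk>
    \<Longrightarrow> pseudo_move P (relocate \<sigma> ` P)"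
| PR1: "\<lbrakk>p \<in> P; kind p = Precrossing; adjacent (endpoints P) (tail p) (head p)\<rbrakk>
    \<Longrightarrow> pseudo_move P (P - {p})"
| PR2_positive: "\<lbrakk>x \<in> P; p \<in> P; kind x = Classical 1; kind p = Precrossing;
     adjacent (endpoints P) (tail x) (head p); adjacent (endpoints P) (head x) (tail p);
     \<sigma> = exchange (tail x) (head p) \<circ> exchange (head x) (tail p)\<rbrakk>
    \<Longrightarrow> pseudo_move P
          ((P - {x, p}) \<union> {reverse (relocate \<sigma> x), reverse (relocate \<sigma> p)})"
| PR2_negative: "\<lbrakk>x \<in> P; p \<in> P; kind x = Classical (-1); kind p = Precrossing;
     adjacent (endpoints P) (tail x) (tail p); adjacent (endpoints P) (head x) (head p);
     \<sigma> = exchange (tail x) (tail p) \<circ> exchange (head x) (head p)\<rbrakk>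
    \<Longrightarrow> pseudo_move P
          ((P - {x, p}) \<union> {reverse (relocate \<sigma> x), reverse (relocate \<sigma> p)})"
| PR3: "\<lbrakk>p \<in> P; a \<in> P; b \<in> P; a \<noteq> b;
     kind p = Precrossing; kind a = Classical \<epsilon>\<^sub>a; kind b = Classical \<epsilon>\<^sub>b; \<eta> \<in> {1, -1};
     arc_sign P (end_of \<eta> a) (end_of \<eta> b) o\<^sub>T; arc_sign P (end_of (- \<eta>) a) (tail p) o\<^sub>X;
     arc_sign P (end_of (- \<eta>) b) (head p) o\<^sub>Y;
     \<eta> * o\<^sub>X * \<epsilon>\<^sub>a = \<eta> * o\<^sub>Y * \<epsilon>\<^sub>b; \<eta> * o\<^sub>Y * \<epsilon>\<^sub>b = o\<^sub>T * \<epsilon>\<^sub>a * \<epsilon>\<^sub>b;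
     \<sigma> = exchange (end_of \<eta> a) (end_of \<eta> b) \<circ> exchange (end_of (- \<eta>) a) (tail p)
         \<circ> exchange (end_of (- \<eta>) b) (head p)\<rbrakk>
    \<Longrightarrow> pseudo_move P (relocate \<sigma> ` P)"

inductive crossing_change :: "arrow set \<Rightarrow> arrow set \<Rightarrow> bool" where
  "\<lbrakk>a \<in> P; kind a = Classical \<epsilon>\<rbrakk>
    \<Longrightarrow> crossing_change P (insert (Arrow (head a) (tail a) (Classical (- \<epsilon>))) (P - {a}))"

text \<open>Diagrams are considered up to homeomorphism, so that homeomorphisms are among the generators.\<close>

definition homotopic_diagrams :: "arrow set \<Rightarrow> arrow set \<Rightarrow> bool" where
  "homotopic_diagrams = equivclp (\<lambda>P Q.
     pseudo_Gauss_diagram P \<and> pseudo_Gauss_diagram Q \<and>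
     (diagram_homeo P Q \<or> pseudo_move P Q \<or> crossing_change P Q))"


section \<open>Chord diagrams decorated by \<open>\<int>\<^sub>2\<close>\<close>

type_synonym decorated_chord = "complex set \<times> bit"

definition chord_diagram :: "decorated_chord set \<Rightarrow> bool" where
  "chord_diagram D \<longleftrightarrow>
    finite D \<and>
    (\<forall>(c, v)\<in>D. c \<subseteq> circle \<and> card c = 2) \<and>
    (\<forall>x\<in>D. \<forall>y\<in>D. x \<noteq> y \<longrightarrow> fst x \<inter> fst y = {})"

definition chord_diagram_homeo :: "(decorated_chord set \<times> decorated_chord set) set" where
  "chord_diagram_homeo = {(D, E). chord_diagram D \<and> chord_diagram E \<and>
     (\<exists>h. orientation_preserving_homeo h \<and> E = (\<lambda>(c, v). (h ` c, v)) ` D)}"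

definition Z2C :: "decorated_chord set set set" where
  "Z2C = {D. chord_diagram D} // chord_diagram_homeo"


section \<open>The map \<open>I_h\<close>\<close>

definition is_classical :: "arrow \<Rightarrow> bool" where
  "is_classical a \<longleftrightarrow> kind a \<noteq> Precrossing"

definition prechord_parity :: "arrow set \<Rightarrow> complex set \<Rightarrow> bit" where
  "prechord_parity P c = of_nat (card {a \<in> P. is_classical a \<and> intersecting (ends a) c})"

definition decorated_prechords :: "arrow set \<Rightarrow> decorated_chord set" where
  "decorated_prechords P =
    {(ends a, prechord_parity P (ends a)) | a. a \<in> P \<and> kind a = Precrossing}"

definition removable :: "decorated_chord set \<Rightarrow> decorated_chord \<Rightarrow> bool" where
  "removable D c \<longleftrightarrow> snd c = 0 \<and>
     (\<exists>u v. fst c = {u, v} \<and> adjacent (\<Union> (fst ` D)) u v)"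

definition prune :: "decorated_chord set \<Rightarrow> decorated_chord set" where
  "prune D = {c \<in> D. \<not> removable D c}"

text \<open>A deletion may create new removable chords (a \<open>0\<close>-chord enclosing just a deleted one), so
  pruning is repeated until nothing more can be deleted. Every round before that point removes at
  least one chord, hence \<open>card D\<close> rounds suffice.\<close>

definition prune_all :: "decorated_chord set \<Rightarrow> decorated_chord set" where
  "prune_all D = (prune ^^ card D) D"

definition I_h :: "arrow set \<Rightarrow> decorated_chord set set" where
  "I_h P = chord_diagram_homeo `` {prune_all (decorated_prechords P)}"

lemma prune_prune_all:
  assumes "finite D"
  shows "prune (prune_all D) = prune_all D"
proof -
  have "prune ((prune ^^ n) D) = (prune ^^ n) D" if "card D \<le> n" for n
    using assms that
  proof (induction n arbitrary: D)
    case 0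
    then show ?case by (simp add: prune_def)
  next
    case (Suc n)
    show ?case
    proof (cases "prune D = D")
      case True
      then have "(prune ^^ k) D = D" for k
        by (induction k) auto
      with True show ?thesis by metis
    next
      case False
      then have "prune D \<subset> D" by (auto simp: prune_def)
      then have "card (prune D) < card D" using Suc.prems psubset_card_mono by blast
      moreover have "finite (prune D)" using Suc.prems by (simp add: prune_def)
      ultimately show ?thesis using Suc.IH[of "prune D"] Suc.prems by (simp add: funpow_swap1)
    qed
  qed
  then show ?thesis by (simp add: prune_all_def)
qed

lemma I_h_in_Z2C:
  assumes "pseudo_Gauss_diagram P"
  shows "I_h P \<in> Z2C"
proof -
  let ?D = "decorated_prechords P"
  have "?D = (\<lambda>a. (ends a, prechord_parity P (ends a))) ` {a \<in> P. kind a = Precrossing}"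
    by (auto simp: decorated_prechords_def)
  then have fin: "finite ?D" using assms by (simp add: pseudo_Gauss_diagram_def)
  have disj: "fst x \<inter> fst y = {}" if x: "x \<in> ?D" and y: "y \<in> ?D" and "x \<noteq> y" for x y
  proof -
    obtain a where a: "a \<in> P" "x = (ends a, prechord_parity P (ends a))"
      using x by (auto simp: decorated_prechords_def)
    obtain b where b: "b \<in> P" "y = (ends b, prechord_parity P (ends b))"
      using y by (auto simp: decorated_prechords_def)
    have "a \<noteq> b" using a b \<open>x \<noteq> y\<close> by blast
    then have "ends a \<inter> ends b = {}"
      using a(1) b(1) assms unfolding pseudo_Gauss_diagram_def by blast
    then show ?thesis using a b by simp
  qed
  have chords: "fst x \<subseteq> circle \<and> card (fst x) = 2" if "x \<in> ?D" for x
  proof -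
    obtain a where a: "a \<in> P" "x = (ends a, prechord_parity P (ends a))"
      using \<open>x \<in> ?D\<close> by (auto simp: decorated_prechords_def)
    then have "ends a \<subseteq> circle" "tail a \<noteq> head a"
      using assms unfolding pseudo_Gauss_diagram_def by blast+
    with a show ?thesis by (simp add: ends_def)
  qed
  have "(prune ^^ n) ?D \<subseteq> ?D" for n
    by (induction n) (auto simp: prune_def)
  then have "prune_all ?D \<subseteq> ?D" by (simp add: prune_all_def)
  note sub = this
  have "chord_diagram (prune_all ?D)"
    unfolding chord_diagram_def
  proof (intro conjI ballI impI)
    show "finite (prune_all ?D)" using fin sub by (rule rev_finite_subset)
  next
    fix x assume "x \<in> prune_all ?D"
    then show "case x of (c, v) \<Rightarrow> c \<subseteq> circle \<and> card c = 2"
      using chords[of x] subsetD[OF sub, of x] by (simp add: case_prod_beta)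
  next
    fix x y assume "x \<in> prune_all ?D" "y \<in> prune_all ?D" "x \<noteq> y"
    then show "fst x \<inter> fst y = {}" using disj sub by blast
  qed
  then show ?thesis unfolding I_h_def Z2C_def by (intro quotientI CollectI)
qed

end

theory Submission
  imports Defs
begin

text \<open>
  Replace each arrow by its pair of endpoints. The decorated prechords of a diagram depend only on
  two families of chords, the classical chords and the prechords: the decoration of a prechord is the
  number modulo 2 of the classical chords that it intersects (\<open>decorated_prechords_eq\<close>). Crossing changes
  do not alter these families at all, and homeomorphisms preserve intersections.

  The moves R3, PR2 and PR3 exchange the endpoints in two or three disjoint pairs of adjacent
  endpoints. Exchanging adjacent endpoints \<open>u\<close> and \<open>v\<close> toggles the intersection of two chords iff one of them ends
  in \<open>u\<close> and the other in \<open>v\<close> (\<open>intersecting_exchange\<close>). So the parity of a prechord changes precisely when it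
  trades places with a classical chord. In R3 this never happens; in PR2 and PR3 it happens
  exactly twice, for the precrossing of the move, and the two changes cancel. The prechords
  themselves are changed only by pushing some of their endpoints across arcs that contain no other
  prechord endpoint, which is the effect of an orientation-preserving homeomorphism (\<open>homeo_exchange\<close>).

  The classical arrow deleted by R1 intersects nothing, and the two deleted by R2 intersect the same
  prechords, so no parity changes. The prechord deleted by PR1 has adjacent endpoints and parity 0,
  so pruning deletes it anyway. That pruning leads to the same result whether or not this chord is
  deleted beforehand holds because the result is the greatest subdiagram without removable chords
  (\<open>stable_subset_prune_all\<close>, \<open>prune_all_delete_removable\<close>).
\<close>

section \<open>Arcs and intersections in terms of angles\<close>

lemma circle_cis_Arg: "x \<in> circle \<Longrightarrow> cis (Arg x) = x"
  using rcis_cmod_Arg[of x] by (simp add: circle_def rcis_def)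

lemma cis_in_circle [simp]: "cis t \<in> circle"
  by (simp add: circle_def)

lemma angle_eq_Arg_cis: obtains k :: int where "t = Arg (cis t) + 2 * pi * of_int k"
proof -
  have "sin t = sin (Arg (cis t)) \<and> cos t = cos (Arg (cis t))"
    using circle_cis_Arg[OF cis_in_circle, of t] by (metis cis.sel)
  then obtain k :: int where "t = Arg (cis t) + 2 * pi * of_int k"
    unfolding sin_cos_eq_iff by blast
  then show ?thesis by (rule that)
qed

text \<open>The cyclic order of the circle seen through the argument. The branch cut of \<open>Arg\<close> turns an arc
  into an interval or into the union of two rays, whence the three cases. For \<open>a = b\<close> all angles other
  than \<open>a\<close> lie between, because \<open>ccw_arc x x\<close> is the circle without \<open>x\<close>.\<close>

definition cyclically_between :: "real \<Rightarrow> real \<Rightarrow> real \<Rightarrow> bool" where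
  "cyclically_between a t b \<longleftrightarrow> a < t \<and> t < b \<or> b \<le> a \<and> a < t \<or> t < b \<and> b \<le> a"

text \<open>This reduces every question about arcs with finitely many endpoints to the order of real numbers,
  where it becomes a finite case distinction.\<close>

lemma ccw_arc_iff_Arg:
  assumes "x \<in> circle" "y \<in> circle" "z \<in> circle"
  shows "z \<in> ccw_arc x y \<longleftrightarrow> cyclically_between (Arg x) (Arg z) (Arg y)"
proof
  assume "z \<in> ccw_arc x y"
  then obtain a t b where *: "x = cis a" "z = cis t" "y = cis b" "a < t" "t < b" "b \<le> a + 2 * pi"
    by (auto simp: ccw_arc_def)
  obtain i j k :: int where eqs: "a = Arg x + 2 * pi * of_int i" "t = Arg z + 2 * pi * of_int j"
      "b = Arg y + 2 * pi * of_int k"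
    using angle_eq_Arg_cis * by metis
  \<comment> \<open>As all lifts lie within one turn of \<open>a\<close>, they differ from the arguments by at most one turn more.\<close>
  define m n where "m = j - i" and "n = k - i"
  have t: "t = a + (Arg z - Arg x) + 2 * pi * of_int m"
    and b: "b = a + (Arg y - Arg x) + 2 * pi * of_int n"
    by (simp_all add: eqs m_def n_def algebra_simps)
  note bounds = Arg_bounded[of x] Arg_bounded[of y] Arg_bounded[of z]
  have "2 * pi * of_int m < 2 * pi * 2" "2 * pi * (-1) < 2 * pi * of_int m"
    "2 * pi * of_int n < 2 * pi * 2" "2 * pi * (-1) < 2 * pi * of_int n"
    using t b bounds * by linarith+
  then have "of_int m < (2::real)" "(-1::real) < of_int m" "of_int n < (2::real)" "(-1::real) < of_int n"
    by - (rule mult_left_less_imp_less[where c = "2 * pi"], assumption, simp)+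
  then have "m \<in> {0, 1}" "n \<in> {0, 1}" by auto
  then show "cyclically_between (Arg x) (Arg z) (Arg y)"
    using t b bounds * unfolding cyclically_between_def by auto
next
  assume L: "cyclically_between (Arg x) (Arg z) (Arg y)"
  note bounds = Arg_bounded[of x] Arg_bounded[of y] Arg_bounded[of z]
  have arc: "z \<in> ccw_arc x y"
    if "a < t" "t < b" "b \<le> a + 2 * pi" "cis a = x" "cis t = z" "cis b = y" for a b t
    unfolding ccw_arc_def using that by blast
  have turn: "cis (Arg u + 2 * pi) = u" if "u \<in> circle" for u
    using that by (simp add: circle_cis_Arg flip: cis_mult)
  from L consider "Arg x < Arg z" "Arg z < Arg y" | "Arg y \<le> Arg x" "Arg x < Arg z"
    | "Arg z < Arg y" "Arg y \<le> Arg x"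
    unfolding cyclically_between_def by blast
  then show "z \<in> ccw_arc x y"
  proof cases
    case 1
    then show ?thesis using arc[of "Arg x" "Arg z" "Arg y"] bounds assms by (simp add: circle_cis_Arg)
  next
    case 2
    then show ?thesis using arc[of "Arg x" "Arg z" "Arg y + 2 * pi"] bounds assms
      by (simp add: circle_cis_Arg turn)
  next
    case 3
    then show ?thesis using arc[of "Arg x" "Arg z + 2 * pi" "Arg y + 2 * pi"] bounds assms
      by (simp add: circle_cis_Arg turn)
  qed
qed

lemma Arg_inj_circle: "x \<in> circle \<Longrightarrow> y \<in> circle \<Longrightarrow> Arg x = Arg y \<longleftrightarrow> x = y"
  by (metis circle_cis_Arg)

lemma ccw_arc_asym:
  assumes "x \<in> circle" "y \<in> circle" "z \<in> circle" "x \<noteq> y" "z \<in> ccw_arc x y"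
  shows "z \<notin> ccw_arc y x"
  using assms Arg_inj_circle[of x y] by (auto simp: ccw_arc_iff_Arg cyclically_between_def)

lemma intersecting_pairs:
  assumes "x \<noteq> y"
  shows "intersecting {x, y} {z, w} \<longleftrightarrow>
    z \<in> ccw_arc x y \<and> w \<in> ccw_arc y x \<or> w \<in> ccw_arc x y \<and> z \<in> ccw_arc y x"
  unfolding intersecting_def by (auto simp: doubleton_eq_iff)

lemma adjacent_mono: "adjacent E u v \<Longrightarrow> F \<subseteq> E \<Longrightarrow> adjacent F u v"
  unfolding adjacent_def consecutive_def by blast

lemma adjacent_sym: "adjacent E u v \<longleftrightarrow> adjacent E v u"
  unfolding adjacent_def by blast

text \<open>Otherwise \<open>x\<close> and \<open>y\<close> would lie on different arcs between \<open>u\<close> and \<open>v\<close>, so that neither of these arcs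
  would be free of \<open>E\<close>.\<close>

lemma adjacent_same_side:
  assumes "adjacent E u v" "E \<subseteq> circle" "u \<in> circle" "v \<in> circle" "x \<in> E - {u, v}" "y \<in> E - {u, v}"
  shows "u \<in> ccw_arc x y \<longleftrightarrow> v \<in> ccw_arc x y"
proof -
  have c: "x \<in> circle" "y \<in> circle" using assms by auto
  have ne: "Arg u \<noteq> Arg v" "Arg x \<noteq> Arg u" "Arg x \<noteq> Arg v" "Arg y \<noteq> Arg u" "Arg y \<noteq> Arg v"
    using assms c by (auto simp: Arg_inj_circle adjacent_def consecutive_def)
  have "x \<notin> ccw_arc u v \<and> y \<notin> ccw_arc u v \<or> x \<notin> ccw_arc v u \<and> y \<notin> ccw_arc v u"
    using assms by (auto simp: adjacent_def consecutive_def)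
  then show ?thesis
    using ne assms(3,4) c by (simp add: ccw_arc_iff_Arg cyclically_between_def) argo
qed

text \<open>Seen from \<open>x\<close> and \<open>y\<close>, which lie on a common arc between \<open>u\<close> and \<open>v\<close>, the trade just reverses the
  order of \<open>u\<close> and \<open>v\<close>, and that order decides whether the chords alternate.\<close>

lemma intersecting_pairs_swap:
  assumes "adjacent E u v" "E \<subseteq> circle" "{u,v,x,y} \<subseteq> E" "distinct [u,v,x,y]"
  shows "intersecting {u, x} {v, y} \<longleftrightarrow> \<not> intersecting {v, x} {u, y}"
proof -
  have c: "x \<in> circle" "y \<in> circle" "u \<in> circle" "v \<in> circle" using assms by auto
  have ne: "Arg u \<noteq> Arg v" "Arg x \<noteq> Arg u" "Arg x \<noteq> Arg v" "Arg y \<noteq> Arg u" "Arg y \<noteq> Arg v" "Arg x \<noteq> Arg y"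
    using assms(4) c by (auto simp: Arg_inj_circle)
  have "x \<notin> ccw_arc u v \<and> y \<notin> ccw_arc u v \<or> x \<notin> ccw_arc v u \<and> y \<notin> ccw_arc v u"
    using assms by (auto simp: adjacent_def consecutive_def)
  then show ?thesis
    using ne c assms(4) by (simp add: intersecting_pairs ccw_arc_iff_Arg cyclically_between_def) argo
qed

lemma intersecting_commute_pairs:
  assumes "{x,y,z,w} \<subseteq> circle" "distinct [x,y,z,w]"
  shows "intersecting {x, y} {z, w} \<longleftrightarrow> intersecting {z, w} {x, y}"
proof -
  have c: "x \<in> circle" "y \<in> circle" "z \<in> circle" "w \<in> circle" using assms by auto
  have ne: "Arg x \<noteq> Arg y" "Arg z \<noteq> Arg x" "Arg z \<noteq> Arg y" "Arg w \<noteq> Arg x" "Arg w \<noteq> Arg y" "Arg z \<noteq> Arg w"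
    using assms(2) c by (auto simp: Arg_inj_circle)
  then show ?thesis
    using ne c assms(2) by (simp add: intersecting_pairs ccw_arc_iff_Arg cyclically_between_def) argo
qed

lemma intersecting_commute:
  assumes "c \<subseteq> circle" "d \<subseteq> circle" "card c = 2" "card d = 2" "c \<inter> d = {}"
  shows "intersecting c d \<longleftrightarrow> intersecting d c"
  using assms by (auto simp: card_2_iff intro!: intersecting_commute_pairs)

text \<open>By \<open>adjacent_same_side\<close>, \<open>u\<close> and \<open>v\<close> lie on the same side of \<open>d\<close>.\<close>

lemma adjacent_chord_not_intersecting:
  assumes adj: "adjacent E u v" and E: "E \<subseteq> circle" "{u, v} \<subseteq> E"
    and d: "d \<subseteq> E" "card d = 2" "d \<inter> {u, v} = {}"
  shows "\<not> intersecting {u, v} d" "\<not> intersecting d {u, v}"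
proof -
  obtain z w where zw: "d = {z, w}" "z \<noteq> w" using d by (auto simp: card_2_iff)
  have uv: "u \<noteq> v" using adj by (auto simp: adjacent_def consecutive_def)
  have c: "z \<in> circle" "w \<in> circle" "u \<in> circle" "v \<in> circle" using zw d E by auto
  have "u \<in> ccw_arc z w \<longleftrightarrow> v \<in> ccw_arc z w" "u \<in> ccw_arc w z \<longleftrightarrow> v \<in> ccw_arc w z"
    using adjacent_same_side[OF adj E(1) c(3,4)] zw d by auto
  then show *: "\<not> intersecting d {u, v}"
    using ccw_arc_asym[OF c(1,2)] c zw by (auto simp: intersecting_pairs)
  then show "\<not> intersecting {u, v} d"
    using intersecting_commute[of "{u, v}" d] d E uv by auto
qed


section \<open>Orientation-preserving homeomorphisms of the circle\<close>

lemma homeo_comp: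
  assumes "orientation_preserving_homeo h" "orientation_preserving_homeo k"
  shows "orientation_preserving_homeo (k \<circ> h)"
proof -
  obtain g f where h: "homeomorphism circle circle h g" "continuous_on UNIV f" "strict_mono f"
    "\<And>t. f (t + 2 * pi) = f t + 2 * pi" "\<And>t. h (cis t) = cis (f t)"
    using assms(1) unfolding orientation_preserving_homeo_def by blast
  obtain g' f' where k: "homeomorphism circle circle k g'" "continuous_on UNIV f'" "strict_mono f'"
    "\<And>t. f' (t + 2 * pi) = f' t + 2 * pi" "\<And>t. k (cis t) = cis (f' t)"
    using assms(2) unfolding orientation_preserving_homeo_def by blast
  have "homeomorphism circle circle (k \<circ> h) (g \<circ> g')"
    using h(1) k(1) by (rule homeomorphism_compose)
  moreover have "continuous_on UNIV (f' \<circ> f)"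
    using h(2) k(2) by (blast intro: continuous_on_compose continuous_on_subset)
  moreover have "strict_mono (f' \<circ> f)"
    using h(3) k(3) by (rule strict_mono_compose[unfolded comp_def[symmetric], rotated])
  moreover have "\<forall>t. (f' \<circ> f) (t + 2 * pi) = (f' \<circ> f) t + 2 * pi"
    "\<forall>t. (k \<circ> h) (cis t) = cis ((f' \<circ> f) t)"
    using h k by simp_all
  ultimately show ?thesis unfolding orientation_preserving_homeo_def by blast
qed

lemma homeo_id: "orientation_preserving_homeo id"
  unfolding orientation_preserving_homeo_def
  by (intro conjI exI[of _ id]) (auto simp: strict_mono_def homeomorphism_def)

text \<open>The values at the multiples of a full turn are unbounded in both directions, so the intermediate
  value theorem applies.\<close>

lemma degree_one_lift_surj:
  fixes f :: "real \<Rightarrow> real"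
  assumes "continuous_on UNIV f" and per: "\<And>t. f (t + 2 * pi) = f t + 2 * pi"
  shows "surj f"
proof -
  have up: "f (2 * pi * real n) = f 0 + 2 * pi * real n" for n
  proof (induction n)
    case (Suc n)
    then show ?case using per[of "2 * pi * real n"] by (simp add: algebra_simps)
  qed simp
  have down: "f (- (2 * pi * real n)) = f 0 - 2 * pi * real n" for n
  proof (induction n)
    case (Suc n)
    then show ?case using per[of "- (2 * pi * real (Suc n))"] by (simp add: algebra_simps)
  qed simp
  have "\<exists>x. f x = y" for y
  proof -
    obtain n where n: "\<bar>y - f 0\<bar> / (2 * pi) \<le> real n" using real_arch_simple by blast
    then have "\<bar>y - f 0\<bar> \<le> 2 * pi * real n" by (simp add: field_simps)
    then have "f (- (2 * pi * real n)) \<le> y" "y \<le> f (2 * pi * real n)"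
      unfolding up down by linarith+
    then show ?thesis
      using IVT'[of f "- (2 * pi * real n)" y "2 * pi * real n"] assms(1)
      by (auto intro: continuous_on_subset)
  qed
  then show ?thesis by (metis surjI)
qed

text \<open>The inverse of a lift is a lift of the inverse, which makes homeomorphism of diagrams symmetric.\<close>

lemma homeo_inverse:
  assumes "orientation_preserving_homeo h"
  obtains g where "orientation_preserving_homeo g" "homeomorphism circle circle h g"
proof -
  obtain g f where h: "homeomorphism circle circle h g" "continuous_on UNIV f" "strict_mono f"
    "\<And>t. f (t + 2 * pi) = f t + 2 * pi" "\<And>t. h (cis t) = cis (f t)"
    using assms(1) unfolding orientation_preserving_homeo_def by blast
  have bij: "bij f"
    using degree_one_lift_surj h(2,4) h(3) by (auto simp: bij_def strict_mono_imp_inj_on)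
  define k where "k = inv f"
  have fk: "f (k y) = y" and kf: "k (f x) = x" for x y
    using bij by (simp_all add: k_def bij_is_surj surj_f_inv_f bij_is_inj)
  have mono: "strict_mono k"
    by (rule strict_monoI) (metis fk h(3) strict_mono_less)
  have "continuous_on UNIV k"
  proof (rule continuous_at_imp_continuous_on, rule ballI)
    fix y
    show "isCont k y"
      using isCont_inverse_function[of 1 "k y" k f] kf h(2)
      by (simp add: fk continuous_on_eq_continuous_at)
  qed
  moreover have "k (t + 2 * pi) = k t + 2 * pi" for t
    by (metis fk kf h(4))
  moreover have "g (cis t) = cis (k t)" for t
  proof -
    have "g (cis t) = g (h (cis (k t)))" by (simp add: h(5) fk)
    also have "\<dots> = cis (k t)" using h(1) by (simp add: homeomorphism_apply1)
    finally show ?thesis .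
  qed
  ultimately have "orientation_preserving_homeo g"
    using mono homeomorphism_symD[OF h(1)] unfolding orientation_preserving_homeo_def by blast
  then show ?thesis using that h(1) by blast
qed

lemma homeo_circle: "orientation_preserving_homeo h \<Longrightarrow> x \<in> circle \<Longrightarrow> h x \<in> circle"
  unfolding orientation_preserving_homeo_def homeomorphism_def by blast

lemma homeo_inj: "orientation_preserving_homeo h \<Longrightarrow> inj_on h circle"
  unfolding orientation_preserving_homeo_def homeomorphism_def by (metis inj_on_inverseI)

lemma homeo_arc_imp:
  assumes "orientation_preserving_homeo h" "z \<in> ccw_arc x y"
  shows "h z \<in> ccw_arc (h x) (h y)"
proof -
  obtain f where f: "strict_mono f" "\<And>t. f (t + 2 * pi) = f t + 2 * pi" "\<And>t. h (cis t) = cis (f t)"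
    using assms(1) unfolding orientation_preserving_homeo_def by blast
  obtain a t b where *: "x = cis a" "z = cis t" "y = cis b" "a < t" "t < b" "b \<le> a + 2 * pi"
    using assms(2) by (auto simp: ccw_arc_def)
  have "f a < f t" "f t < f b" "f b \<le> f a + 2 * pi"
    using * f(1) by (auto simp: strict_mono_less strict_mono_less_eq simp flip: f(2))
  then show ?thesis using * f(3) unfolding ccw_arc_def by blast
qed

text \<open>Lifts are increasing and commute with the full turn, so they map arcs to arcs; intersection and
  adjacency, being expressed by arcs, are therefore preserved by homeomorphisms.\<close>

lemma homeo_arc:
  assumes "orientation_preserving_homeo h" "x \<in> circle" "y \<in> circle" "z \<in> circle"
  shows "h z \<in> ccw_arc (h x) (h y) \<longleftrightarrow> z \<in> ccw_arc x y"
proof -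
  obtain g where "orientation_preserving_homeo g" "homeomorphism circle circle h g"
    using assms(1) by (rule homeo_inverse)
  then show ?thesis
    using homeo_arc_imp[of g "h z" "h x" "h y"] homeo_arc_imp[OF assms(1)] assms(2-)
    by (auto simp: homeomorphism_apply1)
qed

lemma homeo_adjacent:
  assumes "orientation_preserving_homeo h" "E \<subseteq> circle" "u \<in> circle" "v \<in> circle"
  shows "adjacent (h ` E) (h u) (h v) \<longleftrightarrow> adjacent E u v"
proof -
  have "ccw_arc (h x) (h y) \<inter> h ` E = {} \<longleftrightarrow> ccw_arc x y \<inter> E = {}" if "x \<in> circle" "y \<in> circle" for x y
    using homeo_arc[OF assms(1) that] assms(2) by blast
  moreover have "h u = h v \<longleftrightarrow> u = v"
    using homeo_inj[OF assms(1)] assms by (auto dest: inj_onD)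
  ultimately show ?thesis using assms by (auto simp: adjacent_def consecutive_def)
qed

lemma homeo_intersecting_imp:
  assumes "orientation_preserving_homeo h" "intersecting c d"
  shows "intersecting (h ` c) (h ` d)"
proof -
  obtain x y z w where "c = {x, y}" "d = {z, w}" "z \<in> ccw_arc x y" "w \<in> ccw_arc y x"
    using assms(2) unfolding intersecting_def by blast
  then show ?thesis
    using homeo_arc_imp[OF assms(1)] unfolding intersecting_def by (metis image_insert image_empty)
qed

lemma homeo_intersecting:
  assumes "orientation_preserving_homeo h" "c \<subseteq> circle" "d \<subseteq> circle"
  shows "intersecting (h ` c) (h ` d) \<longleftrightarrow> intersecting c d"
proof -
  obtain g where g: "orientation_preserving_homeo g" "homeomorphism circle circle h g"
    using assms(1) by (rule homeo_inverse)
  have "g ` h ` c = c" if "c \<subseteq> circle" for c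
    using g(2) that by (force simp: homeomorphism_apply1 image_image subset_iff)
  then show ?thesis
    using homeo_intersecting_imp[OF g(1), of "h ` c" "h ` d"] homeo_intersecting_imp[OF assms(1)]
      assms(2,3) by auto
qed

lemma dist_cis_le: "dist (cis s) (cis t) \<le> \<bar>s - t\<bar>"
proof -
  have "cis s - cis t = cis t * (exp (\<i> * of_real (s - t)) - 1)"
    by (simp add: cis_conv_exp algebra_simps flip: exp_add)
  then have "dist (cis s) (cis t) = norm (exp (\<i> * of_real (s - t)) - 1)"
    by (simp add: dist_norm norm_mult)
  also have "\<dots> = 2 * \<bar>sin ((s - t) / 2)\<bar>"
    using dist_exp_i_1[of "s - t"] by simp
  also have "\<dots> \<le> \<bar>s - t\<bar>"
    using abs_sin_x_le_abs_x[of "(s - t) / 2"] by simp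
  finally show ?thesis .
qed

text \<open>Every point is rotated by an angle proportional to its distance from \<open>F\<close>. The points of \<open>F\<close> stay
  fixed, and since the distance is 1-Lipschitz along the circle, a factor of absolute value below 1
  keeps the lift \<open>t + r * infdist (cis t) F\<close> increasing.\<close>

lemma infdist_homeo:
  assumes "\<bar>r\<bar> < 1"
  shows "orientation_preserving_homeo (\<lambda>z. z * cis (r * infdist z F))" (is "orientation_preserving_homeo ?h")
proof -
  define f where "f t = t + r * infdist (cis t) F" for t
  have lift: "?h (cis t) = cis (f t)" for t
    by (simp add: f_def cis_mult)
  have mono: "strict_mono f"
  proof (rule strict_monoI)
    fix s t :: real assume "s < t"
    have "\<bar>r * (infdist (cis s) F - infdist (cis t) F)\<bar> \<le> \<bar>r\<bar> * dist (cis s) (cis t)"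
      unfolding abs_mult by (intro mult_left_mono infdist_triangle_abs) auto
    also have "\<dots> \<le> \<bar>r\<bar> * (t - s)"
      using dist_cis_le[of s t] \<open>s < t\<close> by (intro mult_left_mono) auto
    also have "\<dots> < t - s" using assms \<open>s < t\<close> by simp
    finally show "f s < f t" by (simp add: f_def algebra_simps)
  qed
  have cont: "continuous_on UNIV f"
    unfolding f_def by (intro continuous_intros)
  have per: "f (t + 2 * pi) = f t + 2 * pi" for t
    by (simp add: f_def flip: cis_mult)
  have "inj_on ?h circle"
  proof (rule inj_onI)
    fix x y assume xy: "x \<in> circle" "y \<in> circle" "?h x = ?h y"
    define s t where "s = Arg x" and "t = Arg y"
    have c: "x = cis s" "y = cis t" using xy by (simp_all add: s_def t_def circle_cis_Arg)
    have "cis (f s) = cis (f t)" using xy(3) unfolding c lift .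
    then obtain k :: int where "f s = f t + 2 * pi * of_int k"
      by (metis cis.sel sin_cos_eq_iff)
    moreover have "f (t + 2 * pi * of_int k) = f t + 2 * pi * of_int k"
      by (simp add: f_def flip: cis_mult)
    ultimately have "s = t + 2 * pi * of_int k"
      using mono by (metis strict_mono_eq)
    then show "x = y" by (simp add: c flip: cis_mult)
  qed
  moreover have "?h ` circle = circle"
  proof
    show "?h ` circle \<subseteq> circle" by (auto simp: circle_def norm_mult)
    show "circle \<subseteq> ?h ` circle"
    proof
      fix y assume "y \<in> circle"
      obtain t where "f t = Arg y"
        using degree_one_lift_surj[OF cont per] by (metis surjD)
      then have "?h (cis t) = y" using lift \<open>y \<in> circle\<close> by (simp add: circle_cis_Arg)
      then show "y \<in> ?h ` circle" using cis_in_circle by blast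
    qed
  qed
  moreover have "continuous_on circle ?h"
    by (intro continuous_intros)
  ultimately have "\<exists>g. homeomorphism circle circle ?h g"
    using homeomorphism_compact[of circle ?h circle] by (auto simp: circle_def)
  then show ?thesis
    unfolding orientation_preserving_homeo_def using cont mono per lift by blast
qed

text \<open>The small rotations of \<open>infdist_homeo\<close> reach a whole neighbourhood of a point. So the points reachable
  from a given one by homeomorphisms fixing \<open>F\<close> form an open class, and an arc avoiding \<open>F\<close>, being
  connected, lies in a single class.\<close>

lemma homeo_push_along_arc:
  assumes F: "closed F" "F \<noteq> {}" "F \<subseteq> circle" and uv: "u \<in> circle - F" "v \<in> circle - F" "adjacent F u v"
  obtains h where "orientation_preserving_homeo h" "h u = v" "\<And>x. x \<in> F \<Longrightarrow> h x = x"
proof -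
  define R where "R = (\<lambda>x y. \<exists>h. orientation_preserving_homeo h \<and> h x = y \<and> (\<forall>z\<in>F. h z = z))"
  have R_sym: "R y x" if "R x y" "x \<in> circle" for x y
  proof -
    obtain h where h: "orientation_preserving_homeo h" "h x = y" "\<forall>z\<in>F. h z = z"
      using \<open>R x y\<close> unfolding R_def by blast
    obtain g where g: "orientation_preserving_homeo g" "homeomorphism circle circle h g"
      using h(1) by (rule homeo_inverse)
    have "g z = z" if "z \<in> F" for z
      using homeomorphism_apply1[OF g(2), of z] h(3) F(3) that by auto
    moreover have "g y = x" using homeomorphism_apply1[OF g(2) \<open>x \<in> circle\<close>] h(2) by simp
    ultimately show ?thesis using g(1) unfolding R_def by blast
  qed
  have R_trans: "R x z" if xy: "R x y" and yz: "R y z" for x y z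
  proof -
    obtain h where h: "orientation_preserving_homeo h" "h x = y" "\<forall>z\<in>F. h z = z"
      using xy unfolding R_def by blast
    obtain k where k: "orientation_preserving_homeo k" "k y = z" "\<forall>z\<in>F. k z = z"
      using yz unfolding R_def by blast
    show ?thesis
      unfolding R_def by (rule exI[of _ "k \<circ> h"]) (use h k homeo_comp in auto)
  qed
  have R_local: "R (cis s) (cis t)" if "\<bar>t - s\<bar> < infdist (cis s) F" for s t
  proof -
    \<comment> \<open>The factor for which the rotation angle at \<open>cis s\<close> is \<open>t - s\<close>.\<close>
    define r where "r = (t - s) / infdist (cis s) F"
    have pos: "infdist (cis s) F > 0" using that by linarith
    then have "\<bar>r\<bar> < 1" using that by (simp add: r_def abs_div_pos[symmetric])
    then have "orientation_preserving_homeo (\<lambda>z. z * cis (r * infdist z F))" by (rule infdist_homeo)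
    moreover have "cis s * cis (r * infdist (cis s) F) = cis t"
      using pos by (simp add: r_def cis_mult)
    ultimately show ?thesis
      unfolding R_def by (intro exI[of _ "\<lambda>z. z * cis (r * infdist z F)"]) simp
  qed
  have along: "R x y" if xy: "x \<in> circle - F" "y \<in> circle - F" "x \<noteq> y" and arc: "ccw_arc x y \<inter> F = {}" for x y
  proof -
    define a where "a = Arg x"
    \<comment> \<open>The first lift of \<open>y\<close> after that of \<open>x\<close>.\<close>
    define b where "b = (if Arg x < Arg y then Arg y else Arg y + 2 * pi)"
    have "Arg x \<noteq> Arg y" using xy by (simp add: Arg_inj_circle)
    then have ab: "a < b" "b \<le> a + 2 * pi"
      unfolding a_def b_def using Arg_bounded[of x] Arg_bounded[of y] by auto
    have ends: "cis a = x" "cis b = y"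
      using xy by (auto simp: a_def b_def circle_cis_Arg simp flip: cis_mult)
    have avoid: "cis t \<notin> F" if "t \<in> {a..b}" for t
    proof (cases "t = a \<or> t = b")
      case False
      then have "cis t \<in> ccw_arc x y"
        unfolding ccw_arc_def using that ab ends by force
      then show ?thesis using arc by blast
    qed (use xy ends in auto)
    have "R (cis a) (cis b)"
    proof (rule connected_equivalence_relation[where S = "{a..b}" and R = "\<lambda>s t. R (cis s) (cis t)"])
      fix s assume "s \<in> {a..b}"
      then have "infdist (cis s) F > 0" using avoid F by (simp add: infdist_pos_not_in_closed)
      then show "\<exists>T. openin (top_of_set {a..b}) T \<and> s \<in> T \<and> (\<forall>t\<in>T. R (cis s) (cis t))"
        using R_local[of _ s] \<open>s \<in> {a..b}\<close>
        by (intro exI[of _ "{a..b} \<inter> ball s (infdist (cis s) F)"])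
          (auto simp: openin_open_Int dist_real_def abs_minus_commute)
    next
      show "R (cis s) (cis r)" if "R (cis s) (cis t)" "R (cis t) (cis r)" for s t r
        using that by (rule R_trans)
    qed (use ab R_sym in auto)
    then show ?thesis by (simp add: ends)
  qed
  have "R u v"
    using uv along R_sym unfolding adjacent_def consecutive_def by blast
  then show ?thesis using that unfolding R_def by blast
qed


section \<open>Pruning and homeomorphisms of chord diagrams\<close>

lemma removable_mono: "removable D c \<Longrightarrow> S \<subseteq> D \<Longrightarrow> removable S c"
  unfolding removable_def by (meson adjacent_mono Union_mono image_mono)

lemma prune_all_subset: "prune_all D \<subseteq> D"
proof -
  have "(prune ^^ n) D \<subseteq> D" for n
    by (induction n) (auto simp: prune_def)
  then show ?thesis by (simp add: prune_all_def)
qed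

text \<open>Deleting other chords cannot make a removable chord irremovable, so no round of pruning touches a
  subset in which nothing is removable. As the result of pruning is itself such a subset, it is the
  greatest one; this description does not mention the order of the deletions.\<close>

lemma stable_subset_prune_all:
  assumes "S \<subseteq> D" "prune S = S"
  shows "S \<subseteq> prune_all D"
proof -
  have "S \<subseteq> (prune ^^ n) D" for n
  proof (induction n)
    case (Suc n)
    then have "S \<subseteq> prune ((prune ^^ n) D)"
      using \<open>prune S = S\<close> removable_mono unfolding prune_def by blast
    then show ?case by simp
  qed (use assms in simp)
  then show ?thesis by (simp add: prune_all_def)
qed

text \<open>Both sides are the greatest subset without removable chords, and that subset avoids \<open>c\<close>.\<close>

lemma prune_all_delete_removable:
  assumes "finite D" "removable D c"
  shows "prune_all (D - {c}) = prune_all D"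
proof
  have "prune (prune_all (D - {c})) = prune_all (D - {c})"
    using assms(1) by (simp add: prune_prune_all)
  then show "prune_all (D - {c}) \<subseteq> prune_all D"
    using prune_all_subset[of "D - {c}"] by (intro stable_subset_prune_all) auto
next
  have st: "prune (prune_all D) = prune_all D"
    using assms(1) by (rule prune_prune_all)
  then have "c \<notin> prune_all D"
    using removable_mono[OF assms(2) prune_all_subset] unfolding prune_def by blast
  then show "prune_all D \<subseteq> prune_all (D - {c})"
    using st prune_all_subset[of D] by (intro stable_subset_prune_all) auto
qed

definition move_chords :: "(complex \<Rightarrow> complex) \<Rightarrow> decorated_chord set \<Rightarrow> decorated_chord set" where
  "move_chords h D = (\<lambda>(c, v). (h ` c, v)) ` D"

lemma Union_move_chords: "\<Union> (fst ` move_chords h D) = h ` \<Union> (fst ` D)"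
  unfolding move_chords_def by force

lemma move_chords_comp: "move_chords k (move_chords h D) = move_chords (k \<circ> h) D"
  unfolding move_chords_def by (force simp: image_image case_prod_beta)

lemma move_chords_cong:
  assumes "\<And>x. x \<in> \<Union> (fst ` D) \<Longrightarrow> h x = k x"
  shows "move_chords h D = move_chords k D"
  unfolding move_chords_def
proof (rule image_cong)
  show "(case p of (c, v) \<Rightarrow> (h ` c, v)) = (case p of (c, v) \<Rightarrow> (k ` c, v))" if "p \<in> D" for p
    using that assms by (auto simp: case_prod_beta intro!: image_cong)
qed simp

lemma chord_diagram_Union: "chord_diagram D \<Longrightarrow> \<Union> (fst ` D) \<subseteq> circle"
  unfolding chord_diagram_def by fastforce

lemma move_chords_inverse:
  assumes "homeomorphism circle circle h g" "\<Union> (fst ` D) \<subseteq> circle"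
  shows "move_chords g (move_chords h D) = D"
proof -
  have "move_chords (g \<circ> h) D = move_chords id D"
    using assms by (intro move_chords_cong) (auto simp: homeomorphism_apply1 subset_iff)
  also have "\<dots> = D" by (simp add: move_chords_def)
  finally show ?thesis by (simp add: move_chords_comp)
qed

lemma removable_homeo:
  assumes h: "orientation_preserving_homeo h" and D: "\<Union> (fst ` D) \<subseteq> circle" and "(c, v) \<in> D"
    and "removable D (c, v)"
  shows "removable (move_chords h D) (h ` c, v)"
proof -
  obtain x y where xy: "v = 0" "c = {x, y}" "adjacent (\<Union> (fst ` D)) x y"
    using assms(4) unfolding removable_def by auto
  have "x \<in> circle" "y \<in> circle" using D assms(3) xy by force+
  then have "adjacent (h ` \<Union> (fst ` D)) (h x) (h y)"
    using xy homeo_adjacent[OF h D] by blast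
  then show ?thesis
    unfolding removable_def Union_move_chords
    by (intro conjI exI[of _ "h x"] exI[of _ "h y"]) (use xy in simp_all)
qed

lemma prune_homeo:
  assumes h: "orientation_preserving_homeo h" and D: "\<Union> (fst ` D) \<subseteq> circle"
  shows "prune (move_chords h D) = move_chords h (prune D)"
proof -
  obtain g where g: "orientation_preserving_homeo g" "homeomorphism circle circle h g"
    using h by (rule homeo_inverse)
  have gh: "move_chords g (move_chords h D) = D" by (rule move_chords_inverse[OF g(2) D])
  have hD: "\<Union> (fst ` move_chords h D) \<subseteq> circle"
    unfolding Union_move_chords using D homeo_circle[OF h] by blast
  have "removable (move_chords h D) (h ` c, v) \<longleftrightarrow> removable D (c, v)" if "(c, v) \<in> D" for c v
  proof
    assume r: "removable (move_chords h D) (h ` c, v)"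
    have "(h ` c, v) \<in> move_chords h D" using that unfolding move_chords_def by force
    then have "removable D (g ` h ` c, v)"
      using removable_homeo[OF g(1) hD _ r] unfolding gh by blast
    moreover have "g ` h ` c = c"
      using D that g(2) by (force simp: image_image homeomorphism_apply1)
    ultimately show "removable D (c, v)" by simp
  qed (rule removable_homeo[OF h D that])
  then show ?thesis unfolding prune_def move_chords_def by (auto simp: image_iff) force+
qed

lemma inj_on_move_chord:
  assumes "orientation_preserving_homeo h" "\<Union> (fst ` D) \<subseteq> circle"
  shows "inj_on (\<lambda>(c, v). (h ` c, v)) D"
proof (rule inj_onI)
  fix p q assume "p \<in> D" "q \<in> D" "(case p of (c, v) \<Rightarrow> (h ` c, v)) = (case q of (c, v) \<Rightarrow> (h ` c, v))"
  moreover have "fst p \<subseteq> circle" "fst q \<subseteq> circle" using assms(2) \<open>p \<in> D\<close> \<open>q \<in> D\<close> by auto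
  ultimately show "p = q"
    using inj_on_image_eq_iff[OF homeo_inj[OF assms(1)]] by (auto simp: case_prod_beta prod_eq_iff)
qed

lemma prune_all_homeo:
  assumes h: "orientation_preserving_homeo h" and D: "\<Union> (fst ` D) \<subseteq> circle"
  shows "prune_all (move_chords h D) = move_chords h (prune_all D)"
proof -
  have "(prune ^^ n) (move_chords h D) = move_chords h ((prune ^^ n) D) \<and> \<Union> (fst ` (prune ^^ n) D) \<subseteq> circle" for n
  proof (induction n)
    case (Suc n)
    have "prune ((prune ^^ n) D) \<subseteq> (prune ^^ n) D" by (auto simp: prune_def)
    then have "\<Union> (fst ` prune ((prune ^^ n) D)) \<subseteq> \<Union> (fst ` (prune ^^ n) D)" by blast
    with Suc have "\<Union> (fst ` prune ((prune ^^ n) D)) \<subseteq> circle" by (meson subset_trans)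
    moreover have "prune (move_chords h ((prune ^^ n) D)) = move_chords h (prune ((prune ^^ n) D))"
      using Suc by (intro prune_homeo[OF h]) blast
    ultimately show ?case using Suc by simp
  qed (use D in simp)
  moreover have "card (move_chords h D) = card D"
    unfolding move_chords_def by (rule card_image[OF inj_on_move_chord[OF h D]])
  ultimately show ?thesis by (simp add: prune_all_def)
qed

lemma chord_diagram_move:
  assumes h: "orientation_preserving_homeo h" and D: "chord_diagram D"
  shows "chord_diagram (move_chords h D)"
  unfolding chord_diagram_def
proof (intro conjI ballI impI)
  have sub: "c \<subseteq> circle \<and> card c = 2" if "(c, v) \<in> D" for c v
    using D that unfolding chord_diagram_def by auto
  show "finite (move_chords h D)" using D by (simp add: chord_diagram_def move_chords_def)
  show "case p of (c, v) \<Rightarrow> c \<subseteq> circle \<and> card c = 2" if pD: "p \<in> move_chords h D" for p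
  proof -
    obtain c v where p: "p = (h ` c, v)" "(c, v) \<in> D" using pD by (auto simp: move_chords_def)
    then have "card (h ` c) = 2"
      using sub[OF p(2)] homeo_inj[OF h] by (metis card_image inj_on_subset)
    then show ?thesis using p sub[OF p(2)] homeo_circle[OF h] by auto
  qed
  show "fst p \<inter> fst q = {}" if pq: "p \<in> move_chords h D" "q \<in> move_chords h D" "p \<noteq> q" for p q
  proof -
    obtain c v where c: "p = (h ` c, v)" "(c, v) \<in> D"
      using pq(1) by (auto simp: move_chords_def)
    obtain d w where d: "q = (h ` d, w)" "(d, w) \<in> D"
      using pq(2) by (auto simp: move_chords_def)
    note cd = c d
    have "c \<inter> d = {}" using D pq(3) cd unfolding chord_diagram_def by fastforce
    then show ?thesis
      using inj_on_image_Int[OF homeo_inj[OF h], of c d] sub cd by auto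
  qed
qed

lemma chord_diagram_subset: "chord_diagram D \<Longrightarrow> S \<subseteq> D \<Longrightarrow> chord_diagram S"
  unfolding chord_diagram_def by (meson finite_subset subsetD)

lemma chord_diagram_homeo_iff:
  "(D, E) \<in> chord_diagram_homeo \<longleftrightarrow>
    chord_diagram D \<and> (\<exists>h. orientation_preserving_homeo h \<and> E = move_chords h D)"
  unfolding chord_diagram_homeo_def move_chords_def[symmetric] using chord_diagram_move by auto

lemma sym_chord_diagram_homeo: "sym chord_diagram_homeo"
proof (rule symI)
  fix D E assume "(D, E) \<in> chord_diagram_homeo"
  then obtain h where h: "chord_diagram D" "orientation_preserving_homeo h" "E = move_chords h D"
    by (auto simp: chord_diagram_homeo_iff)
  obtain g where g: "orientation_preserving_homeo g" "homeomorphism circle circle h g"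
    using h(2) by (rule homeo_inverse)
  have "move_chords g E = D"
    unfolding h(3) by (rule move_chords_inverse[OF g(2) chord_diagram_Union[OF h(1)]])
  then show "(E, D) \<in> chord_diagram_homeo"
    unfolding chord_diagram_homeo_iff using h g chord_diagram_move by auto
qed

lemma trans_chord_diagram_homeo: "trans chord_diagram_homeo"
proof (rule transI)
  fix D E F assume "(D, E) \<in> chord_diagram_homeo" "(E, F) \<in> chord_diagram_homeo"
  then show "(D, F) \<in> chord_diagram_homeo"
    unfolding chord_diagram_homeo_iff using homeo_comp move_chords_comp by metis
qed

text \<open>Pruning commutes with homeomorphisms, so homeomorphic decorated diagrams determine the same element
  of \<open>Z2C\<close> after pruning.\<close>

lemma chord_diagram_class_prune_all_eqI:
  assumes h: "orientation_preserving_homeo h" and D: "chord_diagram D"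
  shows "chord_diagram_homeo `` {prune_all (move_chords h D)} = chord_diagram_homeo `` {prune_all D}"
proof -
  have "(prune_all D, prune_all (move_chords h D)) \<in> chord_diagram_homeo"
    unfolding prune_all_homeo[OF h chord_diagram_Union[OF D]] chord_diagram_homeo_iff
    using h chord_diagram_subset[OF D prune_all_subset] by blast
  then show ?thesis
    using sym_chord_diagram_homeo trans_chord_diagram_homeo by (blast dest: symD transD)
qed

section \<open>The classical chords and the prechords of a diagram\<close>

definition chord_system :: "complex set set \<Rightarrow> bool" where
  "chord_system S \<longleftrightarrow> finite S \<and> (\<forall>c\<in>S. c \<subseteq> circle \<and> card c = 2) \<and> pairwise disjnt S"

definition classical_chords :: "arrow set \<Rightarrow> complex set set" where
  "classical_chords P = ends ` {a \<in> P. is_classical a}"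

definition prechords :: "arrow set \<Rightarrow> complex set set" where
  "prechords P = ends ` {a \<in> P. \<not> is_classical a}"

text \<open>A sum in \<open>\<int>\<^sub>2\<close>, rather than a cardinality reduced modulo 2, makes the effects of exchanges additive.\<close>

definition crossing_parity :: "complex set set \<Rightarrow> complex set \<Rightarrow> bit" where
  "crossing_parity C b = (\<Sum>c\<in>C. of_bool (intersecting c b))"

lemma Union_chords: "\<Union> (classical_chords P \<union> prechords P) = endpoints P"
  unfolding classical_chords_def prechords_def endpoints_def by blast

lemma ends_disjoint:
  "pseudo_Gauss_diagram P \<Longrightarrow> a \<in> P \<Longrightarrow> b \<in> P \<Longrightarrow> x \<in> ends a \<Longrightarrow> x \<in> ends b \<Longrightarrow> a = b"
  unfolding pseudo_Gauss_diagram_def by blast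

lemma inj_on_ends:
  assumes "pseudo_Gauss_diagram P"
  shows "inj_on ends P"
proof (rule inj_onI)
  fix a b assume "a \<in> P" "b \<in> P" "ends a = ends b"
  then show "a = b" using ends_disjoint[OF assms, of a b "tail a"] by (auto simp: ends_def)
qed

lemma chord_system_chords:
  assumes "pseudo_Gauss_diagram P"
  shows "chord_system (classical_chords P \<union> prechords P)" "classical_chords P \<inter> prechords P = {}"
proof -
  have eq: "classical_chords P \<union> prechords P = ends ` P"
    by (auto simp: classical_chords_def prechords_def)
  show "chord_system (classical_chords P \<union> prechords P)"
    unfolding eq chord_system_def pairwise_def
  proof (intro conjI ballI impI)
    show "finite (ends ` P)" using assms by (simp add: pseudo_Gauss_diagram_def)
    show "c \<subseteq> circle" "card c = 2" if "c \<in> ends ` P" for c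
      using that assms by (auto simp: pseudo_Gauss_diagram_def ends_def)
    show "disjnt c d" if "c \<in> ends ` P" "d \<in> ends ` P" "c \<noteq> d" for c d
      using that ends_disjoint[OF assms] unfolding disjnt_iff by blast
  qed
  show "classical_chords P \<inter> prechords P = {}"
    using inj_on_ends[OF assms] by (auto simp: classical_chords_def prechords_def dest: inj_onD)
qed

text \<open>Since the decorated prechords depend on the two families of chords alone, it suffices to follow the
  effect of a move on these families.\<close>

lemma decorated_prechords_eq:
  assumes "pseudo_Gauss_diagram P"
  shows "decorated_prechords P = (\<lambda>b. (b, crossing_parity (classical_chords P) b)) ` prechords P"
proof -
  have "prechord_parity P b = crossing_parity (classical_chords P) b" for b
  proof -
    have "ends ` {a \<in> P. is_classical a \<and> intersecting (ends a) b}
        = classical_chords P \<inter> {c. intersecting c b}"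
      by (auto simp: classical_chords_def)
    moreover have "inj_on ends {a \<in> P. is_classical a \<and> intersecting (ends a) b}"
      using inj_on_ends[OF assms] by (rule inj_on_subset) auto
    ultimately have "card {a \<in> P. is_classical a \<and> intersecting (ends a) b}
        = card (classical_chords P \<inter> {c. intersecting c b})"
      by (metis card_image)
    moreover have "finite (classical_chords P)"
      using chord_system_chords(1)[OF assms] by (simp add: chord_system_def)
    ultimately show ?thesis
      by (simp add: prechord_parity_def crossing_parity_def sum_of_bool_eq)
  qed
  then show ?thesis
    unfolding decorated_prechords_def prechords_def is_classical_def by auto
qed

lemma chord_diagram_decorated_prechords:
  assumes "pseudo_Gauss_diagram P"
  shows "chord_diagram (decorated_prechords P)"
  using chord_system_chords(1)[OF assms]
  unfolding decorated_prechords_eq[OF assms] chord_system_def chord_diagram_def pairwise_def disjnt_def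
  by auto

text \<open>The criterion behind the invariance under all moves except PR1, which changes the prechords by more
  than a homeomorphism.\<close>

lemma I_h_cong:
  assumes P: "pseudo_Gauss_diagram P" and Q: "pseudo_Gauss_diagram Q"
    and h: "orientation_preserving_homeo h"
    and B: "prechords Q = (`) h ` prechords P"
    and par: "\<And>b. b \<in> prechords P \<Longrightarrow>
      crossing_parity (classical_chords Q) (h ` b) = crossing_parity (classical_chords P) b"
  shows "I_h P = I_h Q"
proof -
  have "decorated_prechords Q = move_chords h (decorated_prechords P)"
    unfolding decorated_prechords_eq[OF P] decorated_prechords_eq[OF Q] B move_chords_def
    using par by (simp add: image_image)
  then show ?thesis
    unfolding I_h_def using chord_diagram_class_prune_all_eqI[OF h chord_diagram_decorated_prechords[OF P]]
    by simp
qed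


section \<open>Exchanging adjacent endpoints\<close>

lemma exchange_image_disjoint: "d \<inter> {u, v} = {} \<Longrightarrow> exchange u v ` d = d"
  by (auto simp: Transposition.transpose_def image_iff)

lemma card_exchange_image: "card (exchange u v ` c) = card c"
  by (rule card_image) simp

lemma intersecting_exchange_fixed:
  assumes adj: "adjacent E u v" and E: "E \<subseteq> circle" "{u, v} \<subseteq> E"
    and cd: "c \<subseteq> E" "d \<subseteq> E" "card c = 2" "card d = 2" "c \<inter> d = {}" and d: "d \<inter> {u, v} = {}"
  shows "intersecting (exchange u v ` c) d \<longleftrightarrow> intersecting c d"
proof -
  obtain z w where zw: "d = {z, w}" "z \<noteq> w" using cd by (auto simp: card_2_iff)
  obtain x y where xy: "c = {x, y}" "x \<noteq> y" using cd by (auto simp: card_2_iff)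
  have side: "exchange u v t \<in> ccw_arc p q \<longleftrightarrow> t \<in> ccw_arc p q" if "p \<in> d" "q \<in> d" for t p q
    using adjacent_same_side[OF adj E(1), of p q] that d cd E by (auto simp: Transposition.transpose_def)
  have img: "exchange u v ` c \<subseteq> E" "card (exchange u v ` c) = 2" "exchange u v ` c \<inter> d = {}"
    using cd E d by (auto simp: card_exchange_image) (auto simp: Transposition.transpose_def split: if_splits)
  have "intersecting d (exchange u v ` c) \<longleftrightarrow> intersecting d c"
    using zw by (simp add: xy zw intersecting_pairs side)
  then show ?thesis
    using intersecting_commute[of c d] intersecting_commute[of "exchange u v ` c" d] img cd E by auto
qed

lemma intersecting_exchange_crossed:
  assumes adj: "adjacent E u v" and E: "E \<subseteq> circle"
    and cd: "c \<subseteq> E" "d \<subseteq> E" "card c = 2" "card d = 2" "c \<inter> d = {}" and uv: "u \<in> c" "v \<in> d"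
  shows "intersecting (exchange u v ` c) (exchange u v ` d) \<longleftrightarrow> \<not> intersecting c d"
proof -
  obtain x where x: "c = {u, x}" "x \<noteq> u" using cd uv by (auto simp: card_2_iff)
  obtain y where y: "d = {v, y}" "y \<noteq> v" using cd uv by (auto simp: card_2_iff)
  have ne: "distinct [u, v, x, y]" using x y cd by auto
  then have "exchange u v ` c = {v, x}" "exchange u v ` d = {u, y}"
    unfolding x(1) y(1) by auto
  then show ?thesis using intersecting_pairs_swap[OF adj E _ ne] x y cd by auto
qed

text \<open>Unless one chord ends in \<open>u\<close> and the other in \<open>v\<close>, one of the chords is fixed by the exchange, and the
  endpoints of the other stay on the same sides of it.\<close>

lemma intersecting_exchange:
  assumes adj: "adjacent E u v" and E: "E \<subseteq> circle" "{u, v} \<subseteq> E"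
    and cd: "c \<subseteq> E" "d \<subseteq> E" "card c = 2" "card d = 2" "c \<inter> d = {}"
  shows "intersecting (exchange u v ` c) (exchange u v ` d) \<longleftrightarrow>
    intersecting c d \<noteq> (u \<in> d \<and> v \<in> c \<or> v \<in> d \<and> u \<in> c)"
proof -
  consider "u \<in> c" "v \<in> d" | "v \<in> c" "u \<in> d" | "d \<inter> {u, v} = {}" | "c \<inter> {u, v} = {}"
    using cd(5) by blast
  then show ?thesis
  proof cases
    case 1
    then show ?thesis using intersecting_exchange_crossed[OF adj E(1) cd] by blast
  next
    case 2
    then show ?thesis
      using intersecting_exchange_crossed[of E v u c d] adj E(1) cd
      by (auto simp: transpose_commute adjacent_sym[of E v u])
  next
    case 3
    then have "exchange u v ` d = d" by (rule exchange_image_disjoint)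
    then show ?thesis using intersecting_exchange_fixed[OF adj E cd 3] 3 by auto
  next
    case 4
    then have c: "exchange u v ` c = c" by (rule exchange_image_disjoint)
    have "exchange u v ` d \<subseteq> E" "card (exchange u v ` d) = 2" "c \<inter> exchange u v ` d = {}"
      using cd E 4 by (auto simp: card_exchange_image) (auto simp: Transposition.transpose_def split: if_splits)
    then have "intersecting c (exchange u v ` d) \<longleftrightarrow> intersecting (exchange u v ` d) c"
      using cd E by (intro intersecting_commute) auto
    also have "\<dots> \<longleftrightarrow> intersecting d c"
      using intersecting_exchange_fixed[OF adj E cd(2,1,4,3) _ 4] cd by blast
    also have "\<dots> \<longleftrightarrow> intersecting c d"
      using cd E by (intro intersecting_commute) auto
    finally show ?thesis using 4 c by auto
  qed
qed

text \<open>The change of the parity of a chord \<open>b\<close>, disjoint from those in \<open>C\<close>, under the exchange of \<open>u\<close> and \<open>v\<close>: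
  it is 1 iff one of the two points belongs to \<open>b\<close> and the other to a chord of \<open>C\<close>.\<close>

definition crossing_toggle :: "complex set set \<Rightarrow> complex set \<Rightarrow> complex \<times> complex \<Rightarrow> bit" where
  "crossing_toggle C b = (\<lambda>(u, v). of_bool (u \<in> b \<and> v \<in> \<Union> C) + of_bool (v \<in> b \<and> u \<in> \<Union> C))"

text \<open>At most one of the disjoint sets contains \<open>x\<close>.\<close>

lemma sum_of_bool_mem_disjoint:
  assumes "finite C" "pairwise disjnt C"
  shows "(\<Sum>c\<in>C. of_bool (x \<in> c)) = (of_bool (x \<in> \<Union> C) :: bit)"
proof (cases "x \<in> \<Union> C")
  case True
  then obtain c where c: "c \<in> C" "x \<in> c" by blast
  have "(\<Sum>d\<in>C. of_bool (x \<in> d)) = (\<Sum>d\<in>C. if d = c then 1 else (0 :: bit))"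
  proof (rule sum.cong)
    fix d assume "d \<in> C"
    then show "of_bool (x \<in> d) = (if d = c then 1 else (0 :: bit))"
      using assms(2) c by (auto simp: pairwise_def disjnt_iff)
  qed simp
  then show ?thesis using c True assms(1) by simp
next
  case False
  then have "of_bool (x \<in> c) = (0 :: bit)" if "c \<in> C" for c using that by auto
  then show ?thesis using False by simp
qed

lemma crossing_parity_exchange:
  assumes adj: "adjacent E u v" and E: "E \<subseteq> circle" "{u, v} \<subseteq> E"
    and C: "finite C" "pairwise disjnt C" "\<And>c. c \<in> C \<Longrightarrow> c \<subseteq> E \<and> card c = 2 \<and> c \<inter> b = {}"
    and b: "b \<subseteq> E" "card b = 2"
  shows "crossing_parity ((`) (exchange u v) ` C) (exchange u v ` b)
    = crossing_parity C b + crossing_toggle C b (u, v)"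
proof -
  let ?t = "exchange u v"
  have "inj_on ((`) ?t) C" by (meson inj_image_eq_iff inj_onI inj_transpose)
  then have "crossing_parity ((`) ?t ` C) (?t ` b) = (\<Sum>c\<in>C. of_bool (intersecting (?t ` c) (?t ` b)))"
    by (simp add: crossing_parity_def sum.reindex)
  also have "\<dots> = (\<Sum>c\<in>C. of_bool (intersecting c b) + (of_bool (u \<in> b) * of_bool (v \<in> c)
      + of_bool (v \<in> b) * of_bool (u \<in> c)))"
  proof (rule sum.cong)
    fix c assume "c \<in> C"
    then have "intersecting (?t ` c) (?t ` b) \<longleftrightarrow>
        intersecting c b \<noteq> (u \<in> b \<and> v \<in> c \<or> v \<in> b \<and> u \<in> c)"
      using C(3) b by (intro intersecting_exchange[OF adj E]) auto
    moreover have "\<not> (u \<in> b \<and> u \<in> c)" "\<not> (v \<in> b \<and> v \<in> c)" using C(3)[OF \<open>c \<in> C\<close>] by auto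
    ultimately show "of_bool (intersecting (?t ` c) (?t ` b)) = of_bool (intersecting c b)
        + (of_bool (u \<in> b) * of_bool (v \<in> c) + of_bool (v \<in> b) * (of_bool (u \<in> c) :: bit))"
      by auto
  qed simp
  also have "\<dots> = crossing_parity C b + (of_bool (u \<in> b) * of_bool (v \<in> \<Union> C)
      + of_bool (v \<in> b) * of_bool (u \<in> \<Union> C))"
    unfolding sum.distrib crossing_parity_def sum_distrib_left[symmetric]
      sum_of_bool_mem_disjoint[OF C(1,2)] ..
  finally show ?thesis by (simp only: crossing_toggle_def prod.case of_bool_conj)
qed

text \<open>An exchange that moves at most one point of \<open>V\<close> merely pushes it across an arc free of \<open>V\<close>, which a
  homeomorphism can do. For prechords this says that an exchange of a prechord endpoint with a
  classical one does not alter their diagram. The singletons are excluded because pushing fixes the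
  remaining points of \<open>V\<close>, of which there has to be one.\<close>

lemma homeo_exchange:
  assumes adj: "adjacent E u v" and E: "E \<subseteq> circle" "{u, v} \<subseteq> E"
    and V: "V \<subseteq> E" "finite V" "V \<noteq> {u}" "V \<noteq> {v}" "\<not> (u \<in> V \<and> v \<in> V)"
  obtains h where "orientation_preserving_homeo h" "\<And>x. x \<in> V \<Longrightarrow> h x = exchange u v x"
proof -
  have push: "\<exists>h. orientation_preserving_homeo h \<and> h p = q \<and> (\<forall>x\<in>V - {p}. h x = x)"
    if pq: "adjacent E p q" "p \<in> V" "q \<in> E - V" "V \<noteq> {p}" for p q
  proof -
    have "adjacent (V - {p}) p q" using adjacent_mono[OF pq(1)] V(1) by blast
    moreover have "closed (V - {p})" "V - {p} \<noteq> {}" "V - {p} \<subseteq> circle"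
      "p \<in> circle - (V - {p})" "q \<in> circle - (V - {p})"
      using V(1,2) pq(2-4) E by (auto intro: finite_imp_closed)
    ultimately obtain h where "orientation_preserving_homeo h" "h p = q"
        "\<And>x. x \<in> V - {p} \<Longrightarrow> h x = x"
      using homeo_push_along_arc[of "V - {p}" p q] by metis
    then show ?thesis by blast
  qed
  consider "u \<in> V" "v \<notin> V" | "v \<in> V" "u \<notin> V" | "u \<notin> V" "v \<notin> V" using V(5) by blast
  then show ?thesis
  proof cases
    case 1
    then obtain h where "orientation_preserving_homeo h" "h u = v" "\<forall>x\<in>V - {u}. h x = x"
      using push[of u v] adj V(3) E by auto
    then show ?thesis using 1 by (intro that[of h]) (auto simp: Transposition.transpose_def)
  next
    case 2
    then obtain h where "orientation_preserving_homeo h" "h v = u" "\<forall>x\<in>V - {v}. h x = x"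
      using push[of v u] adj V(4) E by (auto simp: adjacent_sym[of E u v])
    then show ?thesis using 2 by (intro that[of h]) (auto simp: Transposition.transpose_def)
  next
    case 3
    then show ?thesis by (intro that[of id] homeo_id) (auto simp: Transposition.transpose_def)
  qed
qed

text \<open>Lists of pairs treat moves with two and with three displayed arcs uniformly and allow induction over
  the exchanges.\<close>

fun exchanged_points :: "(complex \<times> complex) list \<Rightarrow> complex list" where
  "exchanged_points [] = []"
| "exchanged_points ((u, v) # xs) = u # v # exchanged_points xs"

fun exchanges :: "(complex \<times> complex) list \<Rightarrow> complex \<Rightarrow> complex" where
  "exchanges [] = id"
| "exchanges ((u, v) # xs) = exchange u v \<circ> exchanges xs"

definition separate_adjacent_pairs :: "complex set \<Rightarrow> (complex \<times> complex) list \<Rightarrow> bool" where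
  "separate_adjacent_pairs E xs \<longleftrightarrow>
    (\<forall>(u, v)\<in>set xs. u \<in> E \<and> v \<in> E \<and> adjacent E u v) \<and>
    distinct (exchanged_points xs)"

lemma exchanges_other:
  "x \<notin> set (exchanged_points xs) \<Longrightarrow> exchanges xs x = x"
  by (induction xs rule: exchanges.induct) (auto simp: Transposition.transpose_def)

lemma inj_exchanges: "inj (exchanges xs)"
proof (induction xs rule: exchanges.induct)
  case (2 u v xs)
  then show ?case unfolding exchanges.simps by (intro inj_compose inj_transpose)
qed simp

lemma exchanges_image:
  "(\<And>u v. (u, v) \<in> set xs \<Longrightarrow> u \<in> E \<and> v \<in> E) \<Longrightarrow> exchanges xs ` E = E"
proof (induction xs rule: exchanges.induct)
  case (2 u v xs)
  have "exchanges xs ` E = E" by (rule "2.IH") (rule "2.prems", simp)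
  moreover have "exchange u v ` E = E" using "2.prems"[of u v] by simp
  ultimately show ?case by (metis exchanges.simps(2) image_comp)
qed simp

text \<open>Since the exchanged pairs are disjoint, each exchange leaves the points of the other pairs in place.
  Hence the endpoint set, the adjacency of the remaining pairs and the chords to which their points
  belong are the same at every stage, and the toggles add up.\<close>

lemma homeo_parity_exchanges:
  assumes S: "chord_system (C \<union> B)" "C \<inter> B = {}" "E = \<Union> (C \<union> B)"
    and xs: "separate_adjacent_pairs E xs" "\<And>u v. (u, v) \<in> set xs \<Longrightarrow> \<not> (u \<in> \<Union> B \<and> v \<in> \<Union> B)"
  shows "(\<exists>h. orientation_preserving_homeo h \<and> (\<forall>x\<in>\<Union> B. h x = exchanges xs x)) \<and>
    (\<forall>b\<in>B. crossing_parity ((`) (exchanges xs) ` C) (exchanges xs ` b)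
      = crossing_parity C b + (\<Sum>p\<leftarrow>xs. crossing_toggle C b p))"
  using xs
proof (induction xs rule: exchanges.induct)
  case 1
  then show ?case using homeo_id by (auto intro!: exI[of _ id])
next
  case (2 u v xs)
  let ?s = "exchanges xs"
  have IHpre: "separate_adjacent_pairs E xs" "\<And>u v. (u, v) \<in> set xs \<Longrightarrow> \<not> (u \<in> \<Union> B \<and> v \<in> \<Union> B)"
    using "2.prems" by (auto simp: separate_adjacent_pairs_def)
  obtain h where h: "orientation_preserving_homeo h" "\<And>x. x \<in> \<Union> B \<Longrightarrow> h x = ?s x"
    and par: "\<And>b. b \<in> B \<Longrightarrow> crossing_parity ((`) ?s ` C) (?s ` b)
      = crossing_parity C b + (\<Sum>p\<leftarrow>xs. crossing_toggle C b p)"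
    using "2.IH"[OF IHpre] by blast
  have uv: "adjacent E u v" "{u, v} \<subseteq> E" "\<not> (u \<in> \<Union> B \<and> v \<in> \<Union> B)"
    using "2.prems" by (auto simp: separate_adjacent_pairs_def)
  have fixed: "?s u = u" "?s v = v"
    using "2.prems"(1) by (auto intro!: exchanges_other simp: separate_adjacent_pairs_def)
  have mem: "u \<in> ?s ` X \<longleftrightarrow> u \<in> X" "v \<in> ?s ` X \<longleftrightarrow> v \<in> X" for X
    using fixed inj_exchanges[of xs] by (metis inj_image_mem_iff)+
  have sE: "?s ` E = E"
    using IHpre(1) by (intro exchanges_image) (auto simp: separate_adjacent_pairs_def)
  have E: "E \<subseteq> circle" using S(1,3) by (auto simp: chord_system_def)
  have "finite c" if "c \<in> C \<union> B" for c
    using S(1) that by (intro card_ge_0_finite) (simp add: chord_system_def)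
  then have "finite E" using S(1,3) by (simp add: chord_system_def)
  have sB: "?s ` \<Union> B \<subseteq> E" using S(3) sE by blast
  have chord: "?s ` c \<subseteq> E" "card (?s ` c) = 2" if "c \<in> C \<union> B" for c
  proof -
    have "?s ` c \<subseteq> ?s ` E" using that S(3) by (intro image_mono) blast
    then show "?s ` c \<subseteq> E" unfolding sE .
    have "card (?s ` c) = card c" by (intro card_image inj_on_subset[OF inj_exchanges]) simp
    then show "card (?s ` c) = 2" using S(1) that by (simp add: chord_system_def)
  qed
  have not_single: "?s ` \<Union> B \<noteq> {x}" for x
  proof
    assume x: "?s ` \<Union> B = {x}"
    then obtain b where "b \<in> B" by blast
    then have "?s ` b \<subseteq> {x}" using x by blast
    then have "card (?s ` b) \<le> 1" using card_mono[of "{x}" "?s ` b"] by simp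
    then show False using chord(2)[of b] \<open>b \<in> B\<close> by simp
  qed
  obtain k where k: "orientation_preserving_homeo k" "\<And>x. x \<in> ?s ` \<Union> B \<Longrightarrow> k x = exchange u v x"
    using homeo_exchange[OF uv(1) E uv(2) sB finite_subset[OF sB \<open>finite E\<close>] not_single not_single]
      uv(3) mem by metis
  have "orientation_preserving_homeo (k \<circ> h)" using homeo_comp[OF h(1) k(1)] .
  moreover have "\<forall>x\<in>\<Union> B. (k \<circ> h) x = exchanges ((u, v) # xs) x"
  proof
    fix x assume x: "x \<in> \<Union> B"
    then have "?s x \<in> ?s ` \<Union> B" by (rule imageI)
    then show "(k \<circ> h) x = exchanges ((u, v) # xs) x" using k(2) h(2)[OF x] by simp
  qed
  moreover have "crossing_parity ((`) (exchanges ((u, v) # xs)) ` C) (exchanges ((u, v) # xs) ` b)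
      = crossing_parity C b + (\<Sum>p\<leftarrow>(u, v) # xs. crossing_toggle C b p)" if b: "b \<in> B" for b
  proof -
    have dis: "pairwise disjnt ((`) ?s ` C)"
      using S(1) by (intro disjoint_image inj_on_subset[OF inj_exchanges])
        (auto simp: chord_system_def intro: pairwise_subset)
    have sep: "?s ` c \<inter> ?s ` b = {}" if "c \<in> C" for c
    proof -
      have "c \<inter> b = {}"
        using S(1,2) b that pairwiseD[of disjnt "C \<union> B" c b] by (auto simp: chord_system_def disjnt_def)
      then show ?thesis by (metis image_Int inj_exchanges image_empty)
    qed
    have "crossing_parity ((`) (exchange u v) ` (`) ?s ` C) (exchange u v ` ?s ` b)
        = crossing_parity ((`) ?s ` C) (?s ` b) + crossing_toggle ((`) ?s ` C) (?s ` b) (u, v)"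
    proof (rule crossing_parity_exchange[OF uv(1) E uv(2) _ dis])
      show "finite ((`) ?s ` C)" using S(1) by (simp add: chord_system_def)
      show "d \<subseteq> E \<and> card d = 2 \<and> d \<inter> ?s ` b = {}" if "d \<in> (`) ?s ` C" for d
        using that chord sep by blast
      show "?s ` b \<subseteq> E" "card (?s ` b) = 2" using b chord by blast+
    qed
    also have "crossing_toggle ((`) ?s ` C) (?s ` b) (u, v) = crossing_toggle C b (u, v)"
      using mem[of b] mem[of "\<Union> C"] by (simp add: crossing_toggle_def image_Union[symmetric])
    finally show ?thesis
      unfolding par[OF b] by (simp add: image_comp comp_def image_image ac_simps del: add_bit_eq_xor)
  qed
  ultimately show ?case by blast
qed

text \<open>At most one point of each pair is a prechord endpoint, so the exchanges act on the prechords like a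
  homeomorphism; the toggles of each prechord cancel.\<close>

lemma I_h_exchanges:
  assumes P: "pseudo_Gauss_diagram P" and Q: "pseudo_Gauss_diagram Q"
    and xs: "separate_adjacent_pairs (endpoints P) xs"
      "\<And>u v. (u, v) \<in> set xs \<Longrightarrow> \<not> (u \<in> \<Union> (prechords P) \<and> v \<in> \<Union> (prechords P))"
    and toggle: "\<And>b. b \<in> prechords P \<Longrightarrow> (\<Sum>p\<leftarrow>xs. crossing_toggle (classical_chords P) b p) = 0"
    and C: "classical_chords Q = (`) (exchanges xs) ` classical_chords P"
    and B: "prechords Q = (`) (exchanges xs) ` prechords P"
  shows "I_h P = I_h Q"
proof -
  obtain h where h: "orientation_preserving_homeo h" "\<And>x. x \<in> \<Union> (prechords P) \<Longrightarrow> h x = exchanges xs x"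
    and par: "\<And>b. b \<in> prechords P \<Longrightarrow>
      crossing_parity ((`) (exchanges xs) ` classical_chords P) (exchanges xs ` b)
      = crossing_parity (classical_chords P) b + (\<Sum>p\<leftarrow>xs. crossing_toggle (classical_chords P) b p)"
    using homeo_parity_exchanges[OF chord_system_chords[OF P] Union_chords[symmetric] xs] by blast
  have hb: "h ` b = exchanges xs ` b" if "b \<in> prechords P" for b
    using h(2) that by (intro image_cong) auto
  show ?thesis
  proof (rule I_h_cong[OF P Q h(1)])
    show "prechords Q = (`) h ` prechords P" unfolding B by (rule image_cong) (simp_all add: hb)
    show "crossing_parity (classical_chords Q) (h ` b) = crossing_parity (classical_chords P) b"
      if "b \<in> prechords P" for b
      using par[OF that] toggle[OF that] hb[OF that] by (simp add: C)
  qed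
qed


section \<open>Invariance under the generators\<close>

lemma endpoints_circle: "pseudo_Gauss_diagram P \<Longrightarrow> endpoints P \<subseteq> circle"
  unfolding pseudo_Gauss_diagram_def endpoints_def by blast

lemma ends_endpoints: "a \<in> P \<Longrightarrow> ends a \<subseteq> endpoints P"
  unfolding endpoints_def by blast

lemma card_ends: "pseudo_Gauss_diagram P \<Longrightarrow> a \<in> P \<Longrightarrow> card (ends a) = 2"
  by (simp add: pseudo_Gauss_diagram_def ends_def)

lemma end_mem_ends_iff:
  "pseudo_Gauss_diagram P \<Longrightarrow> a \<in> P \<Longrightarrow> b \<in> P \<Longrightarrow> x \<in> ends a \<Longrightarrow> x \<in> ends b \<longleftrightarrow> a = b"
  using ends_disjoint by blast

lemma end_mem_prechords_iff:
  "pseudo_Gauss_diagram P \<Longrightarrow> a \<in> P \<Longrightarrow> x \<in> ends a \<Longrightarrow> x \<in> \<Union> (prechords P) \<longleftrightarrow> \<not> is_classical a"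
  unfolding prechords_def using ends_disjoint by blast

lemma end_mem_classical_chords_iff:
  "pseudo_Gauss_diagram P \<Longrightarrow> a \<in> P \<Longrightarrow> x \<in> ends a \<Longrightarrow> x \<in> \<Union> (classical_chords P) \<longleftrightarrow> is_classical a"
  unfolding classical_chords_def using ends_disjoint by blast

lemma kind_classical: "kind a = Classical e \<Longrightarrow> is_classical a" "kind a = Precrossing \<Longrightarrow> \<not> is_classical a"
  by (simp_all add: is_classical_def)

lemma relocate_simps [simp]:
  "ends (relocate h a) = h ` ends a" "is_classical (relocate h a) = is_classical a"
  by (cases a; simp add: ends_def is_classical_def)+

lemma reverse_simps [simp]:
  "ends (reverse a) = ends a" "is_classical (reverse a) = is_classical a"
  by (cases a; auto simp: ends_def is_classical_def)+

lemma chords_image: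
  assumes "\<And>a. a \<in> P \<Longrightarrow> ends (f a) = h ` ends a \<and> is_classical (f a) = is_classical a"
  shows "classical_chords (f ` P) = (`) h ` classical_chords P" "prechords (f ` P) = (`) h ` prechords P"
proof -
  have "{a \<in> f ` P. is_classical a} = f ` {a \<in> P. is_classical a}"
    "{a \<in> f ` P. \<not> is_classical a} = f ` {a \<in> P. \<not> is_classical a}" using assms by auto
  then show "classical_chords (f ` P) = (`) h ` classical_chords P" "prechords (f ` P) = (`) h ` prechords P"
    unfolding classical_chords_def prechords_def using assms by (simp_all add: image_image)
qed

lemma I_h_diagram_homeo:
  assumes P: "pseudo_Gauss_diagram P" and Q: "pseudo_Gauss_diagram Q" and "diagram_homeo P Q"
  shows "I_h P = I_h Q"
proof -
  obtain h where h: "orientation_preserving_homeo h" "Q = relocate h ` P"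
    using assms(3) unfolding diagram_homeo_def by blast
  have C: "classical_chords Q = (`) h ` classical_chords P" and B: "prechords Q = (`) h ` prechords P"
    unfolding h(2) by (rule chords_image; simp)+
  have circ: "c \<subseteq> circle" if "c \<in> classical_chords P \<union> prechords P" for c
    using chord_system_chords(1)[OF P] that by (simp add: chord_system_def)
  have "inj_on ((`) h) (classical_chords P)"
    using inj_on_image_eq_iff[OF homeo_inj[OF h(1)]] circ by (intro inj_onI) blast
  then have "crossing_parity (classical_chords Q) (h ` b) = crossing_parity (classical_chords P) b"
    if "b \<in> prechords P" for b
    using circ that by (simp add: crossing_parity_def C sum.reindex homeo_intersecting[OF h(1)])
  then show ?thesis using I_h_cong[OF P Q h(1) B] by blast
qed

lemma I_h_crossing_change:
  assumes P: "pseudo_Gauss_diagram P" and Q: "pseudo_Gauss_diagram Q" and "crossing_change P Q"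
  shows "I_h P = I_h Q"
proof -
  obtain a e where a: "a \<in> P" "kind a = Classical e"
    "Q = insert (Arrow (head a) (tail a) (Classical (- e))) (P - {a})"
    using assms(3) by (auto elim: crossing_change.cases)
  define f where "f = (\<lambda>x. if x = a then Arrow (head a) (tail a) (Classical (- e)) else x)"
  have "Q = f ` P" using a by (auto simp: f_def)
  moreover have "ends (f x) = id ` ends x \<and> is_classical (f x) = is_classical x" for x
    using a(2) by (auto simp: f_def ends_def is_classical_def)
  ultimately have C: "classical_chords Q = classical_chords P" and B: "prechords Q = prechords P"
    using chords_image[of P f id] by simp_all
  show ?thesis by (rule I_h_cong[OF P Q homeo_id]) (simp_all add: C B)
qed

text \<open>The common part of R1 and R2. As parities are additive, only the intersections with the deleted chords
  matter.\<close>

lemma I_h_delete_classical: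
  assumes P: "pseudo_Gauss_diagram P" and Q: "pseudo_Gauss_diagram (P - S)"
    and S: "S \<subseteq> P" "\<And>a. a \<in> S \<Longrightarrow> is_classical a"
    and even: "\<And>q. q \<in> P \<Longrightarrow> \<not> is_classical q \<Longrightarrow> crossing_parity (ends ` S) (ends q) = 0"
  shows "I_h P = I_h (P - S)"
proof -
  have B: "prechords (P - S) = prechords P" using S by (auto simp: prechords_def)
  have sub: "ends ` S \<subseteq> classical_chords P" using S by (auto simp: classical_chords_def)
  have "classical_chords (P - S) = classical_chords P - ends ` S"
    using inj_on_ends[OF P] S by (auto simp: classical_chords_def dest: inj_onD)
  moreover have "finite (classical_chords P)"
    using chord_system_chords(1)[OF P] by (simp add: chord_system_def)
  ultimately have par: "crossing_parity (classical_chords P) b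
      = crossing_parity (classical_chords (P - S)) b + crossing_parity (ends ` S) b" for b
    using sub by (simp only: crossing_parity_def sum.subset_diff)
  show ?thesis
  proof (rule I_h_cong[OF P Q homeo_id])
    show "crossing_parity (classical_chords (P - S)) (id ` b) = crossing_parity (classical_chords P) b"
      if "b \<in> prechords P" for b
      using that even par[of b] by (auto simp: prechords_def)
  qed (simp add: B)
qed

lemma I_h_R1:
  assumes P: "pseudo_Gauss_diagram P" and Q: "pseudo_Gauss_diagram (P - {a})"
    and a: "a \<in> P" "is_classical a" "adjacent (endpoints P) (tail a) (head a)"
  shows "I_h P = I_h (P - {a})"
proof (rule I_h_delete_classical[OF P Q])
  fix q assume q: "q \<in> P" "\<not> is_classical q"
  have "ends q \<inter> ends a = {}" using ends_disjoint[OF P q(1) a(1)] q a by blast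
  then have "\<not> intersecting (ends a) (ends q)"
    using adjacent_chord_not_intersecting(1)[OF a(3) endpoints_circle[OF P]]
      ends_endpoints[OF a(1)] ends_endpoints[OF q(1)] card_ends[OF P q(1)]
    unfolding ends_def[of a] by blast
  then show "crossing_parity (ends ` {a}) (ends q) = 0" by (simp add: crossing_parity_def)
qed (use a in auto)

text \<open>Sliding the two endpoints of \<open>a\<close>, one after the other, across the displayed arcs turns its chord into
  that of \<open>b\<close> without passing an endpoint of a prechord. Hence a prechord intersects both or neither.\<close>

lemma I_h_R2:
  assumes P: "pseudo_Gauss_diagram P" and Q: "pseudo_Gauss_diagram (P - {a, b})"
    and ab: "a \<in> P" "b \<in> P" "a \<noteq> b" "is_classical a" "is_classical b"
    and adj: "adjacent (endpoints P) (tail a) (tail b)" "adjacent (endpoints P) (head a) (head b)"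
  shows "I_h P = I_h (P - {a, b})"
proof (rule I_h_delete_classical[OF P Q])
  fix q assume q: "q \<in> P" "\<not> is_classical q"
  have ne: "ends q \<inter> ends a = {}" "ends q \<inter> ends b = {}" "ends a \<inter> ends b = {}"
    using ends_disjoint[OF P] q ab by blast+
  have two: "tail a \<noteq> head a" "tail b \<noteq> head b"
    using P ab(1,2) by (auto simp: pseudo_Gauss_diagram_def)
  have sub: "ends a \<subseteq> endpoints P" "ends b \<subseteq> endpoints P" "ends q \<subseteq> endpoints P"
    using ends_endpoints ab q by auto
  have "intersecting (exchange (tail a) (tail b) ` {tail a, head a}) (ends q)
      \<longleftrightarrow> intersecting {tail a, head a} (ends q)"
    by (rule intersecting_exchange_fixed[OF adj(1) endpoints_circle[OF P]])
      (use sub ne two card_ends[OF P q(1)] in \<open>auto simp: ends_def\<close>)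
  moreover have "exchange (tail a) (tail b) ` {tail a, head a} = {tail b, head a}"
    using ne two by (auto simp: ends_def)
  moreover have "intersecting (exchange (head a) (head b) ` {tail b, head a}) (ends q)
      \<longleftrightarrow> intersecting {tail b, head a} (ends q)"
    by (rule intersecting_exchange_fixed[OF adj(2) endpoints_circle[OF P]])
      (use sub ne two card_ends[OF P q(1)] in \<open>auto simp: ends_def\<close>)
  moreover have "exchange (head a) (head b) ` {tail b, head a} = {tail b, head b}"
    using ne two by (auto simp: ends_def)
  ultimately have "intersecting (ends a) (ends q) \<longleftrightarrow> intersecting (ends b) (ends q)"
    by (simp add: ends_def)
  moreover have "ends a \<noteq> ends b" using inj_on_ends[OF P] ab by (auto dest: inj_onD)
  ultimately show "crossing_parity (ends ` {a, b}) (ends q) = 0"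
    by (simp add: crossing_parity_def del: sum_of_bool_eq)
qed (use ab in auto)

text \<open>The deleted prechord intersects no classical chord, so it carries 0 and is removable.\<close>

lemma I_h_PR1:
  assumes P: "pseudo_Gauss_diagram P" and Q: "pseudo_Gauss_diagram (P - {p})"
    and p: "p \<in> P" "\<not> is_classical p" "adjacent (endpoints P) (tail p) (head p)"
  shows "I_h P = I_h (P - {p})"
proof -
  let ?D = "decorated_prechords P"
  have "\<not> intersecting (ends c) (ends p)" if "c \<in> P" "is_classical c" for c
  proof -
    have "ends c \<inter> ends p = {}" using ends_disjoint[OF P that(1) p(1)] that p by blast
    then show ?thesis
      using adjacent_chord_not_intersecting(2)[OF p(3) endpoints_circle[OF P]]
        ends_endpoints[OF p(1)] ends_endpoints[OF that(1)] card_ends[OF P that(1)]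
      unfolding ends_def[of p] by blast
  qed
  then have par: "crossing_parity (classical_chords P) (ends p) = 0"
    by (auto simp: crossing_parity_def classical_chords_def intro!: sum.neutral)
  have C: "classical_chords (P - {p}) = classical_chords P"
    using p by (auto simp: classical_chords_def)
  have B: "prechords (P - {p}) = prechords P - {ends p}"
    using inj_on_ends[OF P] p by (auto simp: prechords_def dest: inj_onD)
  have D': "decorated_prechords (P - {p}) = ?D - {(ends p, 0)}"
    unfolding decorated_prechords_eq[OF P] decorated_prechords_eq[OF Q] C B using par by auto
  have "\<Union> (fst ` ?D) \<subseteq> endpoints P"
    unfolding decorated_prechords_eq[OF P] using Union_chords[of P] by auto
  then have "adjacent (\<Union> (fst ` ?D)) (tail p) (head p)" by (rule adjacent_mono[OF p(3)])
  then have "removable ?D (ends p, 0)"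
    unfolding removable_def ends_def by (metis fst_conv snd_conv)
  then have "prune_all (?D - {(ends p, 0)}) = prune_all ?D"
    using chord_diagram_decorated_prechords[OF P]
    by (intro prune_all_delete_removable) (simp_all add: chord_diagram_def)
  then show ?thesis by (simp add: I_h_def D')
qed

text \<open>The moves R3 and PR3 at once, according to whether \<open>c\<close> is a classical arrow or a precrossing. A
  precrossing \<open>c\<close> trades places with an endpoint of \<open>a\<close> and with one of \<open>b\<close>, and so is toggled twice; no
  other prechord is toggled.\<close>

lemma I_h_triangle:
  assumes P: "pseudo_Gauss_diagram P" and Q: "pseudo_Gauss_diagram (relocate s ` P)"
    and abc: "a \<in> P" "b \<in> P" "c \<in> P" "distinct [a, b, c]" "is_classical a" "is_classical b"
    and ends: "ends a = {a1, a2}" "ends b = {b1, b2}" "ends c = {c1, c2}"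
    and adj: "adjacent (endpoints P) a1 b1" "adjacent (endpoints P) a2 c1" "adjacent (endpoints P) b2 c2"
    and s: "s = exchange a1 b1 \<circ> exchange a2 c1 \<circ> exchange b2 c2"
  shows "I_h P = I_h (relocate s ` P)"
proof -
  define xs where "xs = [(a1, b1), (a2, c1), (b2, c2)]"
  have s_xs: "s = exchanges xs" by (simp add: s xs_def comp_assoc)
  have in_ends: "a1 \<in> ends a" "a2 \<in> ends a" "b1 \<in> ends b" "b2 \<in> ends b" "c1 \<in> ends c" "c2 \<in> ends c"
    by (simp_all add: ends)
  note points = end_mem_ends_iff[OF P abc(1) _ in_ends(1)] end_mem_ends_iff[OF P abc(1) _ in_ends(2)]
    end_mem_ends_iff[OF P abc(2) _ in_ends(3)] end_mem_ends_iff[OF P abc(2) _ in_ends(4)]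
    end_mem_ends_iff[OF P abc(3) _ in_ends(5)] end_mem_ends_iff[OF P abc(3) _ in_ends(6)]
  note classical = end_mem_classical_chords_iff[OF P abc(1) in_ends(1)]
    end_mem_classical_chords_iff[OF P abc(1) in_ends(2)]
    end_mem_classical_chords_iff[OF P abc(2) in_ends(3)]
    end_mem_classical_chords_iff[OF P abc(2) in_ends(4)]
  have "a1 \<noteq> a2" "b1 \<noteq> b2" "c1 \<noteq> c2"
    using card_ends[OF P] abc(1-3) ends by force+
  moreover have "ends a \<inter> ends b = {}" "ends a \<inter> ends c = {}" "ends b \<inter> ends c = {}"
    using ends_disjoint[OF P] abc by (auto 0 3)
  ultimately have "distinct (exchanged_points xs)" by (auto simp: xs_def ends)
  moreover have "ends a \<subseteq> endpoints P" "ends b \<subseteq> endpoints P" "ends c \<subseteq> endpoints P"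
    using ends_endpoints abc by auto
  ultimately have sep: "separate_adjacent_pairs (endpoints P) xs"
    using adj by (auto simp: separate_adjacent_pairs_def xs_def ends)
  show ?thesis
  proof (rule I_h_exchanges[OF P Q sep])
    show "\<not> (u \<in> \<Union> (prechords P) \<and> v \<in> \<Union> (prechords P))" if "(u, v) \<in> set xs" for u v
      using that end_mem_prechords_iff[OF P] abc in_ends by (auto simp: xs_def simp del: Union_iff)
    show "(\<Sum>p\<leftarrow>xs. crossing_toggle (classical_chords P) d p) = 0" if d: "d \<in> prechords P" for d
    proof -
      obtain q where q: "q \<in> P" "\<not> is_classical q" "d = ends q" using d by (auto simp: prechords_def)
      have "a \<noteq> q" "b \<noteq> q" using q abc by auto
      then have "crossing_toggle (classical_chords P) d (a1, b1) = 0"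
        "crossing_toggle (classical_chords P) d (a2, c1) = of_bool (q = c)"
        "crossing_toggle (classical_chords P) d (b2, c2) = of_bool (q = c)"
        using points[OF q(1)] abc(5,6) classical
        by (auto simp: crossing_toggle_def q(3) simp del: Union_iff)
      then show ?thesis by (simp add: xs_def)
    qed
    show "classical_chords (relocate s ` P) = (`) (exchanges xs) ` classical_chords P"
      "prechords (relocate s ` P) = (`) (exchanges xs) ` prechords P"
      by (rule chords_image; simp add: s_xs)+
  qed
qed

text \<open>Both endpoints of \<open>p\<close> trade places with endpoints of \<open>x\<close>, so \<open>p\<close> is toggled twice. For positive \<open>x\<close>
  the points \<open>p1\<close> and \<open>p2\<close> stand for the head and the tail of \<open>p\<close>, for negative \<open>x\<close> for the tail and the
  head, when \<open>x1\<close> is the tail of \<open>x\<close>.\<close>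

lemma I_h_PR2:
  assumes P: "pseudo_Gauss_diagram P"
    and Q: "pseudo_Gauss_diagram ((P - {x, p}) \<union> {reverse (relocate s x), reverse (relocate s p)})"
    and xp: "x \<in> P" "p \<in> P" "is_classical x" "\<not> is_classical p"
    and ends: "ends x = {x1, x2}" "ends p = {p1, p2}"
    and adj: "adjacent (endpoints P) x1 p1" "adjacent (endpoints P) x2 p2"
    and s: "s = exchange x1 p1 \<circ> exchange x2 p2"
  shows "I_h P = I_h ((P - {x, p}) \<union> {reverse (relocate s x), reverse (relocate s p)})" (is "_ = I_h ?Q")
proof -
  define xs where "xs = [(x1, p1), (x2, p2)]"
  have s_xs: "s = exchanges xs" by (simp add: s xs_def)
  have in_ends: "x1 \<in> ends x" "x2 \<in> ends x" "p1 \<in> ends p" "p2 \<in> ends p"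
    by (simp_all add: ends)
  have "x1 \<noteq> x2" "p1 \<noteq> p2" using card_ends[OF P] xp(1,2) ends by force+
  moreover have "ends x \<inter> ends p = {}" using ends_disjoint[OF P] xp by blast
  ultimately have "distinct (exchanged_points xs)" by (auto simp: xs_def ends)
  moreover have "ends x \<subseteq> endpoints P" "ends p \<subseteq> endpoints P" using ends_endpoints xp by auto
  ultimately have sep: "separate_adjacent_pairs (endpoints P) xs"
    using adj by (auto simp: separate_adjacent_pairs_def xs_def ends)
  \<comment> \<open>The move as a map on arrows: all arrows other than \<open>x\<close> and \<open>p\<close> avoid the exchanged points.\<close>
  define f where "f = (\<lambda>a. if a \<in> {x, p} then reverse (relocate s a) else a)"
  have Q_eq: "?Q = f ` P" using xp by (auto simp: f_def)
  have f: "ends (f a) = exchanges xs ` ends a \<and> is_classical (f a) = is_classical a" if "a \<in> P" for a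
  proof (cases "a \<in> {x, p}")
    case False
    have "exchanges xs t = t" if "t \<in> ends a" for t
    proof (rule exchanges_other)
      show "t \<notin> set (exchanged_points xs)"
        using False that ends_disjoint[OF P \<open>a \<in> P\<close>] xp in_ends by (auto simp: xs_def)
    qed
    then show ?thesis using False by (auto simp: f_def)
  qed (auto simp: f_def s_xs)
  show ?thesis
  proof (rule I_h_exchanges[OF P Q sep])
    show "\<not> (u \<in> \<Union> (prechords P) \<and> v \<in> \<Union> (prechords P))" if "(u, v) \<in> set xs" for u v
      using that end_mem_prechords_iff[OF P] xp in_ends by (auto simp: xs_def simp del: Union_iff)
    show "(\<Sum>p\<leftarrow>xs. crossing_toggle (classical_chords P) d p) = 0" if d: "d \<in> prechords P" for d
    proof -
      obtain q where q: "q \<in> P" "\<not> is_classical q" "d = ends q" using d by (auto simp: prechords_def)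
      have "x \<noteq> q" using q xp by auto
      then have "crossing_toggle (classical_chords P) d (x1, p1) = of_bool (q = p)"
        "crossing_toggle (classical_chords P) d (x2, p2) = of_bool (q = p)"
        using end_mem_ends_iff[OF P _ q(1)] end_mem_classical_chords_iff[OF P] xp in_ends
        by (auto simp: crossing_toggle_def q(3) simp del: Union_iff)
      then show ?thesis by (simp add: xs_def)
    qed
    show "classical_chords ?Q = (`) (exchanges xs) ` classical_chords P"
      "prechords ?Q = (`) (exchanges xs) ` prechords P"
      unfolding Q_eq by (rule chords_image[OF f]; assumption)+
  qed
qed

lemma arc_sign_adjacent: "arc_sign P u v e \<Longrightarrow> adjacent (endpoints P) u v"
  by (auto simp: arc_sign_def adjacent_def)

lemma ends_end_of: "e \<in> {1, -1} \<Longrightarrow> ends a = {end_of e a, end_of (- e) a}"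
  by (auto simp: ends_def end_of_def)

lemma I_h_pseudo_move:
  assumes "pseudo_move P Q" "pseudo_Gauss_diagram P" "pseudo_Gauss_diagram Q"
  shows "I_h P = I_h Q"
  using assms
proof (induction rule: pseudo_move.induct)
  case (R1 a P)
  then show ?case by (intro I_h_R1) (auto simp: kind_classical)
next
  case (R2 a P b)
  then show ?case by (intro I_h_R2) (auto simp: kind_classical)
next
  case (R3 a P b c)
  show ?case
    by (rule I_h_triangle[OF R3.prems R3(1-4) kind_classical(1)[OF R3(5)] kind_classical(1)[OF R3(6)]
      ends_def ends_def ends_def R3(8-10)[THEN arc_sign_adjacent] R3(13)])
next
  case (PR1 p P)
  then show ?case by (intro I_h_PR1) (auto simp: kind_classical)
next
  case (PR2_positive x P p s)
  show ?case
    by (rule I_h_PR2[OF PR2_positive.prems PR2_positive(1,2) kind_classical(1)[OF PR2_positive(3)]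
      kind_classical(2)[OF PR2_positive(4)] ends_def _ PR2_positive(5-7)]) (auto simp: ends_def)
next
  case (PR2_negative x P p s)
  show ?case
    by (rule I_h_PR2[OF PR2_negative.prems PR2_negative(1,2) kind_classical(1)[OF PR2_negative(3)]
      kind_classical(2)[OF PR2_negative(4)] ends_def ends_def PR2_negative(5-7)])
next
  case (PR3 p P a b)
  have "distinct [a, b, p]" using PR3 by auto
  then show ?case
    by (rule I_h_triangle[OF PR3.prems PR3(2,3,1) _ kind_classical(1)[OF PR3(6)] kind_classical(1)[OF PR3(7)]
      ends_end_of[OF PR3(8)] ends_end_of[OF PR3(8)] ends_def PR3(9-11)[THEN arc_sign_adjacent] PR3(14)])
qed

theorem theorem3:
  fixes P P' :: "arrow set"
  assumes "pseudo_Gauss_diagram P" and "pseudo_Gauss_diagram P'"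
    and "homotopic_diagrams P P'"
  shows "I_h P = I_h P'"
  using assms(3) unfolding homotopic_diagrams_def
proof (induction rule: equivclp_induct)
  case (step Q R)
  then have "I_h Q = I_h R"
    using I_h_diagram_homeo I_h_pseudo_move I_h_crossing_change by metis
  then show ?case using step.IH by simp
qed simp

end
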